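(* Let $H$ be a complex Hilbert space, let $m\in\mathbb{Z}_{1}$ and let $S\in\mathbf{B}(\ell^{2}(\mathbb{Z},H))$ be an $m$-isometric bilateral weighted shift with invertible weights $(S_{j})_{j\in\mathbb{Z}}\subset\mathbf{B}(H)$. Let $p\in\mathbf{B}(H)_{m-1}[z]$ be the polynomial (associated with $S$) such that $p(0)=I$, $p(n)=\lvert S_{n}\cdots S_{1}\rvert^{2}$ and $p(-n)=\lvert S_{-n+1}^{*}\cdots S_{0}^{*}\rvert^{-2}$ for every $n\in\mathbb{Z}_{1}$. The following conditions are equivalent: (i) $S^{*}$ is $m$-isometric; (ii) $p$ is invertible in $\mathbf{B}(H)_{m-1}[z]$, that is, there exists a polynomial $\widetilde{p}\in\mathbf{B}(H)_{m-1}[z]$ such that $p(z)\cdot\widetilde{p}(z)=\widetilde{p}(z)\cdot p(z)=I$ for every $z\in\mathbb{C}$.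
   Context: $\mathbb{Z}_{p}=\{n\in\mathbb{Z}: n\ge p\}$. $\mathbf{B}(H)$ is the algebra of bounded linear operators on a complex Hilbert space $H$; invertible (for weights) means invertible in $\mathbf{B}(H)$; $\lvert T\rvert=(T^{*}T)^{1/2}$ and, for invertible $T$, $\lvert T\rvert^{-2}=(T^{*}T)^{-1}$. The product $S_{-n+1}^{*}\cdots S_{0}^{*}$ is $S_{-n+1}^{*}S_{-n+2}^{*}\cdots S_{-1}^{*}S_{0}^{*}$ (increasing indices), and $S_{n}\cdots S_{1}$ has decreasing indices. $\ell^{2}(\mathbb{Z},H)$ is the Hilbert space of square-summable two-sided sequences $(h_{i})_{i\in\mathbb{Z}}$ in $H$. For a uniformly bounded sequence $(S_{i})_{i\in\mathbb{Z}}\subset\mathbf{B}(H)$, the bilateral weighted shift $S$ with weights $(S_{i})_{i\in\mathbb{Z}}$ is the bounded operator on $\ell^{2}(\mathbb{Z},H)$ given by $S(h_{i})_{i\in\mathbb{Z}}=(S_{i}h_{i-1})_{i\in\mathbb{Z}}$. A bounded operator $T$ is $m$-isometric ($m\in\mathbb{Z}_{1}$) if $\sum_{k=0}^{m}\binom{m}{k}(-1)^{m-k}T^{*k}T^{k}=0$. $\mathbf{B}(H)_{n}[z]$ denotes the space of polynomials $p(z)=\sum_{j=0}^{n}A_{j}z^{j}$ with coefficients $A_{j}\in\mathbf{B}(H)$ (degree at most $n$), evaluated at scalars $z\in\mathbb{C}$. For an $m$-isometric bilateral weighted shift with invertible weights, a polynomial $p$ with the listed interpolation properties exists and is uniqu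e. *)

theory Defs
  imports "HOL-Analysis.Analysis"
begin

section \<open>Complex Hilbert spaces\<close>

text \<open>The inner product is linear in its first argument. The norm, metric and topology are those
  of the underlying real normed space; the last axiom of \<open>complex_inner\<close> says that this
  norm comes from the inner product. The zero space is admitted.\<close>

class complex_vector = real_vector +
  fixes scaleC :: "complex \<Rightarrow> 'a \<Rightarrow> 'a" (infixr "*\<^sub>C" 75)
  assumes scaleC_add_right: "a *\<^sub>C (x + y) = a *\<^sub>C x + a *\<^sub>C y"
    and scaleC_add_left: "(a + b) *\<^sub>C x = a *\<^sub>C x + b *\<^sub>C x"
    and scaleC_scaleC: "a *\<^sub>C b *\<^sub>C x = (a * b) *\<^sub>C x"
    and scaleR_scaleC: "r *\<^sub>R x = complex_of_real r *\<^sub>C x"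

class complex_inner = complex_vector + real_normed_vector +
  fixes cinner :: "'a \<Rightarrow> 'a \<Rightarrow> complex"
  assumes cinner_commute: "cinner x y = cnj (cinner y x)"
    and cinner_add_left: "cinner (x + y) z = cinner x z + cinner y z"
    and cinner_scaleC_left: "cinner (c *\<^sub>C x) y = c * cinner x y"
    and cinner_self: "cinner x x = complex_of_real ((norm x)\<^sup>2)"

class chilbert_space = complex_inner + complete_space

lemma cinner_add_right: "cinner x (y + z) = cinner x y + cinner (x :: 'a::complex_inner) z"
  by (metis cinner_add_left cinner_commute complex_cnj_add)

lemma cinner_scaleC_right: "cinner x (c *\<^sub>C y) = cnj c * cinner (x :: 'a::complex_inner) y"
  by (metis cinner_scaleC_left cinner_commute complex_cnj_mult)

lemma norm_scaleC: "norm (c *\<^sub>C x) = cmod c * norm (x :: 'a::complex_inner)"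
proof -
  have "complex_of_real ((norm (c *\<^sub>C x))\<^sup>2) = c * cnj c * complex_of_real ((norm x)\<^sup>2)"
    by (simp only: cinner_self[symmetric] cinner_scaleC_left cinner_scaleC_right mult.assoc mult.left_commute)
  also have "\<dots> = complex_of_real ((cmod c * norm x)\<^sup>2)"
    by (simp add: complex_norm_square[symmetric] power_mult_distrib)
  finally have "(norm (c *\<^sub>C x))\<^sup>2 = (cmod c * norm x)\<^sup>2"
    by (simp only: of_real_eq_iff)
  then show ?thesis by simp
qed

lemma complex_Cauchy_Schwarz: "cmod (cinner x y) \<le> norm x * norm (y :: 'a::complex_inner)"
proof (cases "y = 0")
  case True
  have "cinner x (0 + 0) = cinner x 0 + cinner x (0::'a)" by (rule cinner_add_right)
  with True show ?thesis by simp
next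
  case False
  then have n: "norm y > 0" by simp
  define b where "b = cinner x y"
  define c where "c = - (b / complex_of_real ((norm y)\<^sup>2))"
  have "complex_of_real ((norm (x + c *\<^sub>C y))\<^sup>2)
      = complex_of_real ((norm x)\<^sup>2) + cnj c * b + c * cnj b
        + c * cnj c * complex_of_real ((norm y)\<^sup>2)"
    unfolding cinner_self[symmetric] b_def
    by (simp add: cinner_add_left cinner_add_right cinner_scaleC_left cinner_scaleC_right
        cinner_commute[of y x] algebra_simps)
  also have "\<dots> = complex_of_real ((norm x)\<^sup>2 - (cmod b)\<^sup>2 / (norm y)\<^sup>2)"
  proof -
    define N where "N = complex_of_real ((norm y)\<^sup>2)"
    have "N \<noteq> 0" "cnj N = N" using n by (simp_all add: N_def)
    then have "cnj c * b + c * cnj b + c * cnj c * N = - (b * cnj b / N)"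
      unfolding c_def N_def[symmetric] by (simp add: field_simps)
    moreover have "b * cnj b / N = complex_of_real ((cmod b)\<^sup>2 / (norm y)\<^sup>2)"
      unfolding N_def by (simp only: of_real_divide complex_norm_square)
    ultimately have "cnj c * b + c * cnj b + c * cnj c * N
        = - complex_of_real ((cmod b)\<^sup>2 / (norm y)\<^sup>2)"
      by presburger
    then show ?thesis unfolding N_def of_real_diff by (simp only: add.assoc diff_conv_add_uminus)
  qed
  finally have "(norm (x + c *\<^sub>C y))\<^sup>2 = (norm x)\<^sup>2 - (cmod b)\<^sup>2 / (norm y)\<^sup>2"
    by (simp only: of_real_eq_iff)
  then have "(cmod b)\<^sup>2 / (norm y)\<^sup>2 \<le> (norm x)\<^sup>2"
    by (smt (verit) zero_le_power2)
  then have "(cmod b)\<^sup>2 \<le> (norm x * norm y)\<^sup>2"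
    using n by (simp add: divide_simps power_mult_distrib)
  then show ?thesis
    unfolding b_def by (rule power2_le_imp_le) simp
qed

lemma bounded_linear_scaleC: "bounded_linear (\<lambda>x. c *\<^sub>C (x :: 'a::complex_inner))"
proof (rule bounded_linear_intro[where K = "cmod c"])
  show "c *\<^sub>C r *\<^sub>R x = r *\<^sub>R c *\<^sub>C x" for r :: real and x :: 'a
    by (simp add: scaleR_scaleC scaleC_scaleC mult.commute)
qed (simp_all add: scaleC_add_right norm_scaleC mult.commute)


section \<open>The algebra of bounded complex-linear operators on a Hilbert space\<close>

typedef (overloaded) 'a bop =
  "{T :: 'a::chilbert_space \<Rightarrow>\<^sub>L 'a. \<forall>c x. blinfun_apply T (c *\<^sub>C x) = c *\<^sub>C blinfun_apply T x}"
  morphisms blinfun_of_bop Bop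
proof -
  have "c *\<^sub>C (0::'a) = 0" for c
    using scaleC_add_right[of c 0 "0::'a"] by simp
  then show ?thesis by (intro exI[of _ 0]) simp
qed

setup_lifting type_definition_bop

lift_definition bop_apply :: "'a::chilbert_space bop \<Rightarrow> 'a \<Rightarrow> 'a" is blinfun_apply .

instantiation bop :: (chilbert_space) real_normed_algebra
begin

lift_definition zero_bop :: "'a bop" is 0
  using scaleC_add_right[of _ 0 "0::'a"] by simp
lift_definition plus_bop :: "'a bop \<Rightarrow> 'a bop \<Rightarrow> 'a bop" is "(+)"
  by (simp add: blinfun.add_left scaleC_add_right)
lift_definition uminus_bop :: "'a bop \<Rightarrow> 'a bop" is uminus
  by (simp add: blinfun.minus_left linear_neg[OF bounded_linear.linear[OF bounded_linear_scaleC]])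
lift_definition minus_bop :: "'a bop \<Rightarrow> 'a bop \<Rightarrow> 'a bop" is "(-)"
  by (simp add: blinfun.diff_left linear_diff[OF bounded_linear.linear[OF bounded_linear_scaleC]])
lift_definition scaleR_bop :: "real \<Rightarrow> 'a bop \<Rightarrow> 'a bop" is scaleR
  by (simp add: blinfun.scaleR_left scaleR_scaleC scaleC_scaleC mult.commute)
lift_definition times_bop :: "'a bop \<Rightarrow> 'a bop \<Rightarrow> 'a bop" is blinfun_compose
  by simp
lift_definition norm_bop :: "'a bop \<Rightarrow> real" is norm .

definition sgn_bop :: "'a bop \<Rightarrow> 'a bop"
  where "sgn_bop T = inverse (norm T) *\<^sub>R T"
definition dist_bop :: "'a bop \<Rightarrow> 'a bop \<Rightarrow> real"
  where "dist_bop S T = norm (S - T)"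
definition uniformity_bop :: "('a bop \<times> 'a bop) filter"
  where "uniformity_bop = (INF e\<in>{0 <..}. principal {(x, y). dist x y < e})"
definition open_bop :: "'a bop set \<Rightarrow> bool"
  where "open_bop U = (\<forall>x\<in>U. \<forall>\<^sub>F (x', y) in uniformity. x' = x \<longrightarrow> y \<in> U)"

instance
proof
  fix S T U :: "'a bop" and r s :: real
  show "S + T + U = S + (T + U)" by transfer simp
  show "S + T = T + S" by transfer simp
  show "0 + T = T" by transfer simp
  show "- T + T = 0" by transfer simp
  show "S - T = S + - T" by transfer simp
  show "r *\<^sub>R (S + T) = r *\<^sub>R S + r *\<^sub>R T" by transfer (rule scaleR_add_right)
  show "(r + s) *\<^sub>R T = r *\<^sub>R T + s *\<^sub>R T" by transfer (rule scaleR_add_left)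
  show "r *\<^sub>R s *\<^sub>R T = (r * s) *\<^sub>R T" by transfer simp
  show "1 *\<^sub>R T = T" by transfer simp
  show "S * T * U = S * (T * U)"
    by transfer (rule blinfun_eqI, simp)
  show "(S + T) * U = S * U + T * U"
    by transfer (rule blinfun_eqI, simp add: blinfun.add_left)
  show "S * (T + U) = S * T + S * U"
    by transfer (rule blinfun_eqI, simp add: blinfun.add_left blinfun.add_right)
  show "r *\<^sub>R S * T = r *\<^sub>R (S * T)"
    by transfer (rule blinfun_eqI, simp add: blinfun.scaleR_left)
  show "S * r *\<^sub>R T = r *\<^sub>R (S * T)"
    by transfer (rule blinfun_eqI, simp add: blinfun.scaleR_left blinfun.scaleR_right)
  show "norm T = 0 \<longleftrightarrow> T = 0" by transfer simp
  show "norm (S + T) \<le> norm S + norm T" by transfer (rule norm_triangle_ineq)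
  show "norm (r *\<^sub>R T) = \<bar>r\<bar> * norm T" by transfer simp
  show "norm (S * T) \<le> norm S * norm T" by transfer (rule norm_blinfun_compose)
qed (simp_all add: sgn_bop_def dist_bop_def uniformity_bop_def open_bop_def)

end

text \<open>Only \<^class>\<open>monoid_mult\<close>, not \<^class>\<open>ring_1\<close>, since $0 = I$ on the zero space.\<close>

instantiation bop :: (chilbert_space) monoid_mult
begin

lift_definition one_bop :: "'a bop" is id_blinfun by simp

instance
  by standard (transfer, rule blinfun_eqI, simp)+

end

instantiation bop :: (chilbert_space) complex_vector
begin

lift_definition scaleC_bop :: "complex \<Rightarrow> 'a bop \<Rightarrow> 'a bop"
  is "\<lambda>c T. blinfun_compose (Blinfun (scaleC c)) T"
  by (simp add: bounded_linear_Blinfun_apply[OF bounded_linear_scaleC] scaleC_scaleC mult.commute)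

instance
  by standard
    (transfer, rule blinfun_eqI,
      simp add: bounded_linear_Blinfun_apply[OF bounded_linear_scaleC] scaleC_add_right
        scaleC_add_left scaleC_scaleC scaleR_scaleC blinfun.add_left blinfun.scaleR_left)+

end

lemma bop_eqI: "(\<And>x. bop_apply S x = bop_apply T x) \<Longrightarrow> S = T"
  by transfer (rule blinfun_eqI)

lemma bop_apply_simps [simp]:
  "bop_apply 0 x = 0"
  "bop_apply (S + T) x = bop_apply S x + bop_apply T x"
  "bop_apply (S - T) x = bop_apply S x - bop_apply T x"
  "bop_apply (- T) x = - bop_apply T x"
  "bop_apply (r *\<^sub>R T) x = r *\<^sub>R bop_apply T x"
  "bop_apply (c *\<^sub>C T) x = c *\<^sub>C bop_apply T x"
  "bop_apply 1 x = x"
  "bop_apply (S * T) x = bop_apply S (bop_apply T x)"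
  by (transfer, simp add: blinfun.add_left blinfun.diff_left blinfun.minus_left
      blinfun.scaleR_left bounded_linear_Blinfun_apply[OF bounded_linear_scaleC])+

text \<open>The objects described by the three definite descriptions below exist and are unique: the
  adjoint always, the inverse for invertible operators and the positive square root for positive
  operators.\<close>

definition bop_adj :: "'a::chilbert_space bop \<Rightarrow> 'a bop"
  where "bop_adj T = (THE T'. \<forall>x y. cinner (bop_apply T x) y = cinner x (bop_apply T' y))"

definition bop_invertible :: "'a::chilbert_space bop \<Rightarrow> bool"
  where "bop_invertible T \<longleftrightarrow> (\<exists>T'. T * T' = 1 \<and> T' * T = 1)"

definition bop_inv :: "'a::chilbert_space bop \<Rightarrow> 'a bop"
  where "bop_inv T = (THE T'. T * T' = 1 \<and> T' * T = 1)"

definition bop_positive :: "'a::chilbert_space bop \<Rightarrow> bool"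
  where "bop_positive T \<longleftrightarrow> (\<forall>x. cinner (bop_apply T x) x \<in> \<real>\<^sub>\<ge>\<^sub>0)"

definition bop_sqrt :: "'a::chilbert_space bop \<Rightarrow> 'a bop"
  where "bop_sqrt T = (THE R. bop_positive R \<and> R * R = T)"

definition bop_abs :: "'a::chilbert_space bop \<Rightarrow> 'a bop"
  where "bop_abs T = bop_sqrt (bop_adj T * T)"

definition m_isometric :: "nat \<Rightarrow> 'a::chilbert_space bop \<Rightarrow> bool"
  where "m_isometric m T \<longleftrightarrow>
    (\<Sum>k=0..m. (real (m choose k) * (-1) ^ (m - k)) *\<^sub>R (bop_adj T ^ k * T ^ k)) = 0"

text \<open>Polynomials with operator coefficients are identified with the functions they induce on
  $\mathbf{C}$; the coefficients are determined by the function.\<close>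

definition bop_polys :: "nat \<Rightarrow> (complex \<Rightarrow> 'a::chilbert_space bop) set"
  where "bop_polys n = {p. \<exists>A :: nat \<Rightarrow> 'a bop. \<forall>z. p z = (\<Sum>j=0..n. z ^ j *\<^sub>C A j)}"


section \<open>Square-summable two-sided sequences\<close>

typedef (overloaded) 'a l2int =
  "{h :: int \<Rightarrow> 'a::chilbert_space. (\<lambda>i. (norm (h i))\<^sup>2) summable_on UNIV}"
  morphisms l2_nth L2int
  by (intro exI[of _ "\<lambda>_. 0"]) simp

setup_lifting type_definition_l2int

lemma l2_nth_summable: "(\<lambda>i. (norm (l2_nth h i))\<^sup>2) summable_on UNIV"
  using l2_nth[of h] by simp

lemma l2_nth_eqI: "(\<And>i. l2_nth f i = l2_nth g i) \<Longrightarrow> f = g"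
  by transfer auto

lemma summable_norm_sq_boundedI:
  fixes h :: "int \<Rightarrow> 'a::real_normed_vector"
  assumes "\<And>F. finite F \<Longrightarrow> L2_set (\<lambda>i. norm (h i)) F \<le> B"
  shows "(\<lambda>i. (norm (h i))\<^sup>2) summable_on UNIV" "sqrt (\<Sum>\<^sub>\<infinity>i. (norm (h i))\<^sup>2) \<le> B"
proof -
  have B: "0 \<le> B" using assms[of "{}"] by simp
  have le: "(\<Sum>i\<in>F. (norm (h i))\<^sup>2) \<le> B\<^sup>2" if "finite F" for F
    using assms[OF that] B unfolding L2_set_def by (simp add: real_le_lsqrt sqrt_le_D)
  show s: "(\<lambda>i. (norm (h i))\<^sup>2) summable_on UNIV"
    by (rule nonneg_bounded_partial_sums_imp_summable_on[where C = "B\<^sup>2"])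
      (auto intro!: eventually_finite_subsets_at_top_weakI le)
  have "(\<Sum>\<^sub>\<infinity>i. (norm (h i))\<^sup>2) \<le> B\<^sup>2"
    by (rule infsum_le_finite_sums[OF s]) (use le in auto)
  then show "sqrt (\<Sum>\<^sub>\<infinity>i. (norm (h i))\<^sup>2) \<le> B"
    using B by (simp add: real_le_lsqrt infsum_nonneg)
qed

lemma L2_set_le_infsum:
  fixes h :: "int \<Rightarrow> 'a::real_normed_vector"
  assumes "(\<lambda>i. (norm (h i))\<^sup>2) summable_on UNIV" "finite F"
  shows "L2_set (\<lambda>i. norm (h i)) F \<le> sqrt (\<Sum>\<^sub>\<infinity>i. (norm (h i))\<^sup>2)"
proof -
  have "(\<Sum>i\<in>F. (norm (h i))\<^sup>2) \<le> (\<Sum>\<^sub>\<infinity>i. (norm (h i))\<^sup>2)"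
    using assms by (intro finite_sum_le_infsum) auto
  then show ?thesis unfolding L2_set_def by simp
qed

lemma L2_set_add_le:
  fixes f g :: "int \<Rightarrow> 'a::real_normed_vector"
  assumes "(\<lambda>i. (norm (f i))\<^sup>2) summable_on UNIV" "(\<lambda>i. (norm (g i))\<^sup>2) summable_on UNIV"
    and "finite F"
  shows "L2_set (\<lambda>i. norm (f i + g i)) F
    \<le> sqrt (\<Sum>\<^sub>\<infinity>i. (norm (f i))\<^sup>2) + sqrt (\<Sum>\<^sub>\<infinity>i. (norm (g i))\<^sup>2)"
proof -
  have "L2_set (\<lambda>i. norm (f i + g i)) F \<le> L2_set (\<lambda>i. norm (f i) + norm (g i)) F"
    by (rule L2_set_mono) (auto intro: norm_triangle_ineq)
  also have "\<dots> \<le> L2_set (\<lambda>i. norm (f i)) F + L2_set (\<lambda>i. norm (g i)) F"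
    by (rule L2_set_triangle_ineq)
  also have "\<dots> \<le> sqrt (\<Sum>\<^sub>\<infinity>i. (norm (f i))\<^sup>2) + sqrt (\<Sum>\<^sub>\<infinity>i. (norm (g i))\<^sup>2)"
    by (intro add_mono L2_set_le_infsum assms)
  finally show ?thesis .
qed

lemma summable_norm_sq_scaleC:
  fixes f :: "int \<Rightarrow> 'a::complex_inner"
  assumes "(\<lambda>i. (norm (f i))\<^sup>2) summable_on UNIV"
  shows "(\<lambda>i. (norm (c *\<^sub>C f i))\<^sup>2) summable_on UNIV"
  unfolding norm_scaleC power_mult_distrib using assms by (rule summable_on_cmult_right)

lemma summable_norm_sq_uminus:
  fixes f :: "int \<Rightarrow> 'a::complex_inner"
  assumes "(\<lambda>i. (norm (f i))\<^sup>2) summable_on UNIV"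
  shows "(\<lambda>i. (norm (- f i))\<^sup>2) summable_on UNIV"
  using assms by simp

lemma summable_cinner:
  fixes f g :: "int \<Rightarrow> 'a::complex_inner"
  assumes "(\<lambda>i. (norm (f i))\<^sup>2) summable_on UNIV" "(\<lambda>i. (norm (g i))\<^sup>2) summable_on UNIV"
  shows "(\<lambda>i. cinner (f i) (g i)) summable_on UNIV"
proof (rule abs_summable_summable, rule summable_on_comparison_test)
  show "(\<lambda>i. (norm (f i))\<^sup>2 + (norm (g i))\<^sup>2) summable_on UNIV"
    by (rule summable_on_add[OF assms])
  fix i
  have "cmod (cinner (f i) (g i)) \<le> norm (f i) * norm (g i)"
    by (rule complex_Cauchy_Schwarz)
  also have "\<dots> \<le> (norm (f i))\<^sup>2 + (norm (g i))\<^sup>2"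
  proof -
    have "2 * (norm (f i) * norm (g i)) \<le> (norm (f i))\<^sup>2 + (norm (g i))\<^sup>2"
      using sum_squares_bound[of "norm (f i)" "norm (g i)"] by simp
    moreover have "0 \<le> norm (f i) * norm (g i)" by simp
    ultimately show ?thesis by linarith
  qed
  finally show "norm (cinner (f i) (g i)) \<le> (norm (f i))\<^sup>2 + (norm (g i))\<^sup>2" .
qed auto

instantiation l2int :: (chilbert_space) complex_inner
begin

lift_definition zero_l2int :: "'a l2int" is "\<lambda>_. 0" by simp
lift_definition plus_l2int :: "'a l2int \<Rightarrow> 'a l2int \<Rightarrow> 'a l2int" is "\<lambda>f g i. f i + g i"
  by (rule summable_norm_sq_boundedI(1), rule L2_set_add_le)
lift_definition uminus_l2int :: "'a l2int \<Rightarrow> 'a l2int" is "\<lambda>f i. - f i"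
  by (rule summable_norm_sq_uminus)
lift_definition minus_l2int :: "'a l2int \<Rightarrow> 'a l2int \<Rightarrow> 'a l2int" is "\<lambda>f g i. f i - g i"
  unfolding diff_conv_add_uminus
  by (rule summable_norm_sq_boundedI(1), rule L2_set_add_le) (auto intro: summable_norm_sq_uminus)
lift_definition scaleC_l2int :: "complex \<Rightarrow> 'a l2int \<Rightarrow> 'a l2int" is "\<lambda>c f i. c *\<^sub>C f i"
  by (rule summable_norm_sq_scaleC)
lift_definition scaleR_l2int :: "real \<Rightarrow> 'a l2int \<Rightarrow> 'a l2int" is "\<lambda>r f i. r *\<^sub>R f i"
  unfolding scaleR_scaleC by (rule summable_norm_sq_scaleC)
lift_definition norm_l2int :: "'a l2int \<Rightarrow> real" is "\<lambda>f. sqrt (\<Sum>\<^sub>\<infinity>i. (norm (f i))\<^sup>2)" .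
lift_definition cinner_l2int :: "'a l2int \<Rightarrow> 'a l2int \<Rightarrow> complex"
  is "\<lambda>f g. \<Sum>\<^sub>\<infinity>i. cinner (f i) (g i)" .

definition sgn_l2int :: "'a l2int \<Rightarrow> 'a l2int"
  where "sgn_l2int f = inverse (norm f) *\<^sub>R f"
definition dist_l2int :: "'a l2int \<Rightarrow> 'a l2int \<Rightarrow> real"
  where "dist_l2int f g = norm (f - g)"
definition uniformity_l2int :: "('a l2int \<times> 'a l2int) filter"
  where "uniformity_l2int = (INF e\<in>{0 <..}. principal {(x, y). dist x y < e})"
definition open_l2int :: "'a l2int set \<Rightarrow> bool"
  where "open_l2int U = (\<forall>x\<in>U. \<forall>\<^sub>F (x', y) in uniformity. x' = x \<longrightarrow> y \<in> U)"

instance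
proof
  fix f g h :: "'a l2int" and r s :: real and c d :: complex
  show "f + g + h = f + (g + h)" by transfer (simp add: add.assoc)
  show "f + g = g + f" by transfer (simp add: add.commute)
  show "0 + f = f" by transfer simp
  show "- f + f = 0" by transfer simp
  show "f - g = f + - g" by transfer simp
  show "r *\<^sub>R (f + g) = r *\<^sub>R f + r *\<^sub>R g" by transfer (simp add: scaleR_add_right)
  show "(r + s) *\<^sub>R f = r *\<^sub>R f + s *\<^sub>R f" by transfer (simp add: scaleR_add_left)
  show "r *\<^sub>R s *\<^sub>R f = (r * s) *\<^sub>R f" by transfer simp
  show "1 *\<^sub>R f = f" by transfer simp
  show "c *\<^sub>C (f + g) = c *\<^sub>C f + c *\<^sub>C g" by transfer (simp add: scaleC_add_right)
  show "(c + d) *\<^sub>C f = c *\<^sub>C f + d *\<^sub>C f" by transfer (simp add: scaleC_add_left)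
  show "c *\<^sub>C d *\<^sub>C f = (c * d) *\<^sub>C f" by transfer (simp add: scaleC_scaleC)
  show "r *\<^sub>R f = complex_of_real r *\<^sub>C f" by transfer (simp add: scaleR_scaleC)
  show "norm f = 0 \<longleftrightarrow> f = 0"
  proof transfer
    fix f :: "int \<Rightarrow> 'a" assume s: "(\<lambda>i. (norm (f i))\<^sup>2) summable_on UNIV"
    show "sqrt (\<Sum>\<^sub>\<infinity>i. (norm (f i))\<^sup>2) = 0 \<longleftrightarrow> f = (\<lambda>_. 0)"
    proof
      assume "sqrt (\<Sum>\<^sub>\<infinity>i. (norm (f i))\<^sup>2) = 0"
      then have "L2_set (\<lambda>j. norm (f j)) {i} \<le> 0" for i
        using L2_set_le_infsum[OF s, of "{i}"] by simp
      then show "f = (\<lambda>_. 0)" by (intro ext) simp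
    qed simp
  qed
  show "norm (f + g) \<le> norm f + norm g"
    by transfer (rule summable_norm_sq_boundedI(2), rule L2_set_add_le)
  show "norm (r *\<^sub>R f) = \<bar>r\<bar> * norm f"
    by transfer (simp add: power_mult_distrib infsum_cmult_right' real_sqrt_mult)
  show "cinner f g = cnj (cinner g f)"
    by transfer (simp only: infsum_cnj[symmetric] cinner_commute[symmetric])
  show "cinner (f + g) h = cinner f h + cinner g h"
    by transfer (simp add: cinner_add_left infsum_add summable_cinner)
  show "cinner (c *\<^sub>C f) g = c * cinner f g"
    by transfer (simp add: cinner_scaleC_left infsum_cmult_right')
  show "cinner f f = complex_of_real ((norm f)\<^sup>2)"
  proof transfer
    fix f :: "int \<Rightarrow> 'a" assume s: "(\<lambda>i. (norm (f i))\<^sup>2) summable_on UNIV"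
    have "((\<lambda>i. complex_of_real ((norm (f i))\<^sup>2))
        has_sum complex_of_real (\<Sum>\<^sub>\<infinity>i. (norm (f i))\<^sup>2)) UNIV"
      by (rule has_sum_of_real) (rule has_sum_infsum[OF s])
    then have "(\<Sum>\<^sub>\<infinity>i. cinner (f i) (f i)) = complex_of_real (\<Sum>\<^sub>\<infinity>i. (norm (f i))\<^sup>2)"
      unfolding cinner_self by (rule infsumI)
    then show "(\<Sum>\<^sub>\<infinity>i. cinner (f i) (f i))
        = complex_of_real ((sqrt (\<Sum>\<^sub>\<infinity>i. (norm (f i))\<^sup>2))\<^sup>2)"
      by (simp add: infsum_nonneg)
  qed
qed (simp_all add: sgn_l2int_def dist_l2int_def uniformity_l2int_def open_l2int_def)

end

lemma L2_set_le_norm: "finite F \<Longrightarrow> L2_set (\<lambda>i. norm (l2_nth f i)) F \<le> norm f"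
  unfolding norm_l2int.rep_eq by (rule L2_set_le_infsum[OF l2_nth_summable])

lemma norm_l2_nth_le: "norm (l2_nth f i) \<le> norm f"
  using L2_set_le_norm[of "{i}" f] by simp

instance l2int :: (chilbert_space) chilbert_space
proof
  fix X :: "nat \<Rightarrow> 'a l2int" assume X: "Cauchy X"
  have "Cauchy (\<lambda>n. l2_nth (X n) i)" for i
  proof (rule metric_CauchyI)
    fix e :: real assume "0 < e"
    then obtain N where N: "\<And>m n. N \<le> m \<Longrightarrow> N \<le> n \<Longrightarrow> dist (X m) (X n) < e"
      using metric_CauchyD[OF X] by meson
    have "dist (l2_nth (X m) i) (l2_nth (X n) i) \<le> dist (X m) (X n)" for m n
      using norm_l2_nth_le[of "X m - X n" i] by (simp add: dist_norm minus_l2int.rep_eq)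
    with N show "\<exists>N. \<forall>m\<ge>N. \<forall>n\<ge>N. dist (l2_nth (X m) i) (l2_nth (X n) i) < e"
      by (meson le_less_trans)
  qed
  then have "convergent (\<lambda>n. l2_nth (X n) i)" for i
    by (rule Cauchy_convergent)
  then obtain L where L: "\<And>i. (\<lambda>n. l2_nth (X n) i) \<longlonglongrightarrow> L i"
    unfolding convergent_def by metis
  have tail: "\<exists>N. \<forall>m\<ge>N. \<forall>F. finite F \<longrightarrow> L2_set (\<lambda>i. norm (l2_nth (X m) i - L i)) F \<le> e"
    if e: "0 < e" for e
  proof -
    obtain N where N: "\<And>m n. N \<le> m \<Longrightarrow> N \<le> n \<Longrightarrow> dist (X m) (X n) < e"
      using metric_CauchyD[OF X e] by meson
    have "L2_set (\<lambda>i. norm (l2_nth (X m) i - L i)) F \<le> e" if m: "N \<le> m" and F: "finite F" for m F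
    proof (rule LIMSEQ_le_const2)
      show "(\<lambda>n. L2_set (\<lambda>i. norm (l2_nth (X m) i - l2_nth (X n) i)) F)
          \<longlonglongrightarrow> L2_set (\<lambda>i. norm (l2_nth (X m) i - L i)) F"
        unfolding L2_set_def by (intro tendsto_intros L)
      have "L2_set (\<lambda>i. norm (l2_nth (X m) i - l2_nth (X n) i)) F \<le> e" if "N \<le> n" for n
        using L2_set_le_norm[OF F, of "X m - X n"] N[OF m that]
        by (simp add: dist_norm minus_l2int.rep_eq)
      then show "\<exists>N. \<forall>n\<ge>N. L2_set (\<lambda>i. norm (l2_nth (X m) i - l2_nth (X n) i)) F \<le> e"
        by blast
    qed
    then show ?thesis by blast
  qed
  obtain N where N: "\<And>F. finite F \<Longrightarrow> L2_set (\<lambda>i. norm (l2_nth (X N) i - L i)) F \<le> 1"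
    using tail[of 1] by auto
  define D where "D = L2int (\<lambda>i. l2_nth (X N) i - L i)"
  have D: "l2_nth D i = l2_nth (X N) i - L i" for i
    unfolding D_def using summable_norm_sq_boundedI(1)[OF N] by (subst L2int_inverse) auto
  define l where "l = X N - D"
  have l: "l2_nth l i = L i" for i
    by (simp add: l_def minus_l2int.rep_eq D)
  have "X \<longlonglongrightarrow> l"
  proof (rule metric_LIMSEQ_I)
    fix r :: real assume r: "0 < r"
    obtain M where M: "\<And>m F. M \<le> m \<Longrightarrow> finite F \<Longrightarrow>
        L2_set (\<lambda>i. norm (l2_nth (X m) i - L i)) F \<le> r / 2"
      using tail[of "r / 2"] r by auto
    have "dist (X m) l \<le> r / 2" if "M \<le> m" for m
      unfolding dist_norm norm_l2int.rep_eq
      by (rule summable_norm_sq_boundedI(2)) (use M[OF that] in \<open>simp add: minus_l2int.rep_eq l\<close>)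
    then show "\<exists>M. \<forall>m\<ge>M. dist (X m) l < r"
      using r by (intro exI[of _ M]) fastforce
  qed
  then show "convergent X" by (rule convergentI)
qed

definition bilateral_weighted_shift ::
    "'a::chilbert_space l2int bop \<Rightarrow> (int \<Rightarrow> 'a bop) \<Rightarrow> bool"
  where "bilateral_weighted_shift S W \<longleftrightarrow>
    bounded (range W) \<and> (\<forall>h i. l2_nth (bop_apply S h) i = bop_apply (W i) (l2_nth h (i - 1)))"

end

theory Submission
  imports Defs
begin

text \<open>Let \<open>A 0 = 1\<close> and \<open>A n = W n * A (n - 1)\<close> for all integers \<open>n\<close>. Then
  \<open>p n = (A n)\<^sup>* * A n\<close>, and \<open>S ^ k * (S\<^sup>*) ^ k\<close> is the diagonal operator with entries
  \<open>A i * (p (i - k))\<^sup>-\<^sup>1 * (A i)\<^sup>*\<close>. So \<open>S\<^sup>*\<close> is $m$-isometric iff the $m$-th differences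
  of the two-sided sequence \<open>(p n)\<^sup>-\<^sup>1\<close> vanish, which happens iff this sequence is interpolated
  by an operator polynomial \<open>q\<close> of degree at most $m - 1$. Since \<open>p * q = q * p = 1\<close> holds at all
  integers, it holds everywhere.\<close>

section \<open>Riesz representation and adjoints\<close>

text \<open>The outer factors of the diagonal entries are invertible and independent of
  \<open>k\<close>, so they can be cancelled from the alternating sum that tests the adjoint; this
  leaves only the inverses of \<open>p n\<close>. Vanishing differences control both half-lines
  because the extreme coefficients of the m-th difference are \<open>1\<close> and
  \<open>(-1) ^ m\<close>. At negative integers \<open>p\<close> is given by moduli of products of
  adjoints; with \<open>A n = bop_inv B\<close> these become \<open>bop_adj (A n) * A n\<close>, the
  same formula as at positive integers. The analytic obstacle lies in the notions themselves.
  Adjoint and modulus are definite descriptions, so nothing can be computed before existence and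
  uniqueness are known; this calls for the Riesz theorem and for positive square roots. Only
  invertible operators occur under a modulus. For such \<open>T\<close> a positive multiple of
  \<open>bop_adj T * T\<close> has distance less than 1 from the identity, and a contraction
  argument takes the place of spectral theory.\<close>

lemma bounded_linear_bop_apply: "bounded_linear (bop_apply T)"
  by transfer (rule blinfun.bounded_linear_right)

lemmas bop_apply_linear_simps [simp] =
  linear_0[OF bounded_linear.linear[OF bounded_linear_bop_apply]]
  linear_add[OF bounded_linear.linear[OF bounded_linear_bop_apply]]
  linear_diff[OF bounded_linear.linear[OF bounded_linear_bop_apply]]
  linear_neg[OF bounded_linear.linear[OF bounded_linear_bop_apply]]
  linear_scale[OF bounded_linear.linear[OF bounded_linear_bop_apply]]
  linear_sum[OF bounded_linear.linear[OF bounded_linear_bop_apply]]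

lemma bop_apply_scaleC [simp]: "bop_apply T (c *\<^sub>C x) = c *\<^sub>C bop_apply T x"
  by transfer simp

lemma bop_apply_sum: "bop_apply (sum f F) x = (\<Sum>i\<in>F. bop_apply (f i) x)"
  by (induction F rule: infinite_finite_induct) simp_all

lemma norm_bop_apply_le: "norm (bop_apply T x) \<le> norm T * norm x"
  by transfer (rule norm_blinfun)

lemma norm_bop_bound:
  assumes "0 \<le> b" "\<And>x. norm (bop_apply T x) \<le> b * norm x"
  shows "norm T \<le> b"
  using assms by transfer (rule norm_blinfun_bound)

lemma bop_of_bounded_linear:
  fixes f :: "'a::chilbert_space \<Rightarrow> 'a"
  assumes "\<And>x y. f (x + y) = f x + f y" "\<And>c x. f (c *\<^sub>C x) = c *\<^sub>C f x"
    and "\<And>x. norm (f x) \<le> K * norm x"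
  shows "\<exists>T. \<forall>x. bop_apply T x = f x"
proof -
  have bl: "bounded_linear f"
    by (rule bounded_linear_intro[where K = K]) (use assms in \<open>simp_all add: scaleR_scaleC mult.commute\<close>)
  show ?thesis
    by (rule exI[of _ "Bop (Blinfun f)"])
      (simp add: bop_apply.rep_eq Bop_inverse bounded_linear_Blinfun_apply[OF bl] assms(2))
qed

section \<open>Sesquilinearity and nondegeneracy of the inner product\<close>

lemma cinner_zero_left [simp]: "cinner 0 (x :: 'a::complex_inner) = 0"
  using cinner_add_left[of 0 0 x] by simp

lemma cinner_zero_right [simp]: "cinner (x :: 'a::complex_inner) 0 = 0"
  using cinner_add_right[of x 0 0] by simp

lemma cinner_minus_left [simp]: "cinner (- x) (y :: 'a::complex_inner) = - cinner x y"
  using cinner_add_left[of x "- x" y] by (simp add: minus_unique)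

lemma cinner_minus_right [simp]: "cinner x (- y :: 'a::complex_inner) = - cinner x y"
  using cinner_add_right[of x y "- y"] by (simp add: minus_unique)

lemma cinner_diff_left: "cinner (x - y) (z :: 'a::complex_inner) = cinner x z - cinner y z"
  using cinner_add_left[of x "- y" z] by simp

lemma cinner_diff_right: "cinner x (y - z :: 'a::complex_inner) = cinner x y - cinner x z"
  using cinner_add_right[of x y "- z"] by simp

lemma cinner_scaleR_left: "cinner (r *\<^sub>R x) (y :: 'a::complex_inner) = of_real r * cinner x y"
  by (simp add: scaleR_scaleC cinner_scaleC_left)

lemma cinner_scaleR_right: "cinner x (r *\<^sub>R y :: 'a::complex_inner) = of_real r * cinner x y"
  by (simp add: scaleR_scaleC cinner_scaleC_right)

lemma cinner_sum_left: "cinner (sum f F) (y :: 'a::complex_inner) = (\<Sum>i\<in>F. cinner (f i) y)"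
  by (induction F rule: infinite_finite_induct) (simp_all add: cinner_add_left)

lemma cinner_ext_right:
  assumes "\<And>x :: 'a::complex_inner. cinner x y = cinner x z"
  shows "y = z"
  using assms[of "y - z"] cinner_self[of "y - z"] by (simp add: cinner_diff_right)

lemma cinner_ext_left:
  assumes "\<And>x :: 'a::complex_inner. cinner y x = cinner z x"
  shows "y = z"
  using assms by (metis cinner_commute cinner_ext_right)

lemma norm_sq_add:
  "(norm (x + y :: 'a::complex_inner))\<^sup>2 = (norm x)\<^sup>2 + 2 * Re (cinner x y) + (norm y)\<^sup>2"
proof -
  have "(norm z)\<^sup>2 = Re (cinner z z)" for z :: 'a by (simp add: cinner_self)
  moreover have "Re (cinner y x) = Re (cinner x y)" by (subst cinner_commute) simp
  ultimately show ?thesis by (simp add: cinner_add_left cinner_add_right)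
qed

text \<open>For small \<open>t\<close> of sign opposite to \<open>a\<close> the linear term
  dominates. This is the first-variation argument at a minimizer.\<close>

lemma quadratic_nonneg_imp_linear_zero:
  fixes a b :: real
  assumes "\<And>t. 0 \<le> t * a + t\<^sup>2 * b"
  shows "a = 0"
proof (rule ccontr)
  assume a: "a \<noteq> 0"
  define t where "t = - a / (\<bar>b\<bar> + 1)"
  have "t * a + t\<^sup>2 * b \<le> t * a + t\<^sup>2 * \<bar>b\<bar>" by (simp add: mult_left_mono)
  also have "\<dots> = - (a\<^sup>2 / (\<bar>b\<bar> + 1)\<^sup>2)"
    unfolding t_def by (simp add: divide_simps power2_eq_square) (simp add: algebra_simps)
  also have "\<dots> < 0" using a by simp
  finally show False using assms[of t] by simp
qed

text \<open>The representing vector is the minimizer of \<open>\<parallel>x\<parallel>\<^sup>2 - 2 f x\<close>; the parallelogram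
  law makes every minimizing sequence Cauchy.\<close>

lemma real_Riesz:
  fixes f :: "'a::chilbert_space \<Rightarrow> real"
  assumes "bounded_linear f"
  shows "\<exists>y. \<forall>x. f x = Re (cinner x y)"
proof -
  interpret f: bounded_linear f by fact
  obtain K where K: "\<And>x. norm (f x) \<le> norm x * K" using f.bounded by blast
  define J where "J x = (norm x)\<^sup>2 - 2 * f x" for x
  have below: "- K\<^sup>2 \<le> J x" for x
  proof -
    have "0 \<le> (norm x - K)\<^sup>2" by simp
    then show ?thesis using K[of x] by (simp add: J_def power2_eq_square algebra_simps)
  qed
  have bdd: "bdd_below (range J)" by (rule bdd_belowI[where m = "- K\<^sup>2"]) (use below in auto)
  define d where "d = Inf (range J)"
  have d: "d \<le> J x" for x unfolding d_def by (rule cInf_lower[OF _ bdd]) simp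
  have "\<exists>x. J x < d + 1 / real (Suc n)" for n
    using cInf_lessD[of "range J" "d + 1 / real (Suc n)"] unfolding d_def by fastforce
  then obtain X where X: "\<And>n. J (X n) < d + 1 / real (Suc n)" by metis
  have par: "(norm (x - y))\<^sup>2 \<le> 2 * (J x - d) + 2 * (J y - d)" for x y
  proof -
    have "(norm (x - y))\<^sup>2 + (norm (x + y))\<^sup>2 = 2 * (norm x)\<^sup>2 + 2 * (norm y)\<^sup>2"
      using norm_sq_add[of x y] norm_sq_add[of x "- y"] by simp
    moreover have "J ((1/2) *\<^sub>R (x + y)) = (norm (x + y))\<^sup>2 / 4 - f x - f y"
      by (simp add: J_def f.scaleR f.add power_divide add_divide_distrib)
    ultimately show ?thesis using d[of "(1/2) *\<^sub>R (x + y)"] by (simp add: J_def)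
  qed
  have "Cauchy X"
  proof (rule metric_CauchyI)
    fix e :: real assume e: "0 < e"
    \<comment> \<open>Beyond \<open>N\<close> each value of \<open>J\<close> exceeds
      \<open>d\<close> by less than a quarter of the square of \<open>e\<close>; the two terms of
      \<open>par\<close>, each doubled, then add up to less than that square.\<close>
    obtain N :: nat where N: "4 / e\<^sup>2 < real N" using reals_Archimedean2 by blast
    have close: "J (X n) < d + e\<^sup>2 / 4" if "N \<le> n" for n
    proof -
      have "4 / e\<^sup>2 < real (Suc n)" using N that by linarith
      then have "1 / real (Suc n) < e\<^sup>2 / 4" using e by (simp add: field_simps)
      then show ?thesis by (rule less_trans[OF X add_strict_left_mono])
    qed
    have "dist (X m) (X n) < e" if "N \<le> m" "N \<le> n" for m n
    proof -
      have "(norm (X m - X n))\<^sup>2 < e\<^sup>2"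
        using par[of "X m" "X n"] close[OF that(1)] close[OF that(2)]
        by simp
      then show ?thesis using e by (simp add: dist_norm power2_less_imp_less)
    qed
    then show "\<exists>M. \<forall>m\<ge>M. \<forall>n\<ge>M. dist (X m) (X n) < e" by blast
  qed
  then obtain y where y: "X \<longlonglongrightarrow> y" using Cauchy_convergent convergent_def by blast
  have "(\<lambda>n. J (X n)) \<longlonglongrightarrow> J y"
    unfolding J_def by (intro tendsto_intros y f.tendsto)
  moreover have "(\<lambda>n. d + 1 / real (Suc n)) \<longlonglongrightarrow> d + 0"
    by (intro tendsto_intros LIMSEQ_Suc[OF lim_1_over_n])
  ultimately have "J y \<le> d + 0"
    by (rule LIMSEQ_le) (use X less_imp_le in blast)
  have "f h = Re (cinner h y)" for h
  proof -
    \<comment> \<open>Since \<open>y\<close> minimizes \<open>J\<close>, the increment of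
      \<open>J\<close> along \<open>t *\<^sub>R h\<close> is a nonnegative quadratic in
      \<open>t\<close>; its linear coefficient is twice the defect to be shown zero.\<close>
    have "0 \<le> t * (2 * (Re (cinner h y) - f h)) + t\<^sup>2 * (norm h)\<^sup>2" for t
    proof -
      have "Re (cinner y h) = Re (cinner h y)" by (subst cinner_commute) simp
      then have "J (y + t *\<^sub>R h) = J y + t * (2 * (Re (cinner h y) - f h)) + t\<^sup>2 * (norm h)\<^sup>2"
        by (simp add: J_def norm_sq_add f.add f.scaleR cinner_scaleR_right power_mult_distrib algebra_simps)
      then show ?thesis using d[of "y + t *\<^sub>R h"] \<open>J y \<le> d + 0\<close> by linarith
    qed
    then show ?thesis using quadratic_nonneg_imp_linear_zero by fastforce
  qed
  then show ?thesis by blast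
qed

lemma bop_adjoint_exists:
  fixes T :: "'a::chilbert_space bop"
  shows "\<exists>T'. \<forall>x y. cinner (bop_apply T x) y = cinner x (bop_apply T' y)"
proof -
  have "\<exists>z. \<forall>x. cinner (bop_apply T x) y = cinner x z" for y
  proof -
    have "bounded_linear (\<lambda>x. Re (cinner (bop_apply T x) y))"
    proof (rule bounded_linear_intro[where K = "norm T * norm y"])
      fix x
      have "norm (Re (cinner (bop_apply T x) y)) \<le> cmod (cinner (bop_apply T x) y)"
        by (simp add: abs_Re_le_cmod)
      also have "\<dots> \<le> norm (bop_apply T x) * norm y" by (rule complex_Cauchy_Schwarz)
      also have "\<dots> \<le> norm x * (norm T * norm y)"
        using mult_right_mono[OF norm_bop_apply_le[of T x], of "norm y"] by (simp add: ac_simps)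
      finally show "norm (Re (cinner (bop_apply T x) y)) \<le> norm x * (norm T * norm y)" .
    qed (simp_all add: cinner_add_left cinner_scaleR_left)
    then obtain z where z: "\<And>x. Re (cinner (bop_apply T x) y) = Re (cinner x z)"
      using real_Riesz by blast
    \<comment> \<open>Real parts agree for all vectors; inserting \<open>\<i> *\<^sub>C x\<close>
      recovers the imaginary parts.\<close>
    have "cinner (bop_apply T x) y = cinner x z" for x
      using z[of x] z[of "\<i> *\<^sub>C x"] by (simp add: complex_eq_iff cinner_scaleC_left)
    then show ?thesis by blast
  qed
  then obtain g where g: "\<And>x y. cinner (bop_apply T x) y = cinner x (g y)" by metis
  have "\<exists>T'. \<forall>x. bop_apply T' x = g x"
  proof (rule bop_of_bounded_linear[where K = "norm T"])
    show "g (x + y) = g x + g y" for x y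
      by (rule cinner_ext_right) (simp add: cinner_add_right flip: g)
    show "g (c *\<^sub>C x) = c *\<^sub>C g x" for c x
      by (rule cinner_ext_right) (simp add: cinner_scaleC_right flip: g)
    show "norm (g x) \<le> norm T * norm x" for x
    proof (cases "g x = 0")
      case False
      \<comment> \<open>The defining identity of \<open>g\<close> is tested on the vector
        \<open>g x\<close> itself; one factor \<open>norm (g x)\<close> cancels afterwards.\<close>
      have "(norm (g x))\<^sup>2 = cmod (cinner (bop_apply T (g x)) x)"
        by (simp add: g cinner_self norm_power)
      also have "\<dots> \<le> norm (bop_apply T (g x)) * norm x" by (rule complex_Cauchy_Schwarz)
      also have "\<dots> \<le> norm T * norm (g x) * norm x"
        by (intro mult_right_mono norm_bop_apply_le) simp
      finally show ?thesis using False by (simp add: power2_eq_square)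
    qed simp
  qed
  then show ?thesis using g by metis
qed

text \<open>Nondegeneracy of the inner product resolves the definite description; the algebraic
  rules for adjoints are all derived through this criterion.\<close>

lemma bop_adj_eqI:
  assumes "\<And>x y. cinner (bop_apply T x) y = cinner x (bop_apply T' y)"
  shows "bop_adj T = T'"
  unfolding bop_adj_def
proof (rule the_equality)
  fix U assume U: "\<forall>x y. cinner (bop_apply T x) y = cinner x (bop_apply U y)"
  show "U = T'"
    by (intro bop_eqI cinner_ext_right) (simp flip: U assms)
qed (simp add: assms)

lemma cinner_bop_adj: "cinner (bop_apply T x) y = cinner x (bop_apply (bop_adj T) y)"
proof -
  obtain T' where "\<And>x y. cinner (bop_apply T x) y = cinner x (bop_apply T' y)"
    using bop_adjoint_exists by blast
  then show ?thesis by (simp add: bop_adj_eqI[of T T'])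
qed

lemma cinner_bop_adj': "cinner (bop_apply (bop_adj T) x) y = cinner x (bop_apply T y)"
  by (metis cinner_bop_adj cinner_commute)

lemma bop_adj_adj [simp]: "bop_adj (bop_adj T) = T"
  by (rule bop_adj_eqI) (rule cinner_bop_adj')

lemma bop_adj_one [simp]: "bop_adj 1 = 1"
  by (rule bop_adj_eqI) simp

lemma bop_adj_mult: "bop_adj (S * T) = bop_adj T * bop_adj S"
  by (rule bop_adj_eqI) (simp add: cinner_bop_adj)

lemma bop_adj_add: "bop_adj (S + T) = bop_adj S + bop_adj T"
  by (rule bop_adj_eqI) (simp add: cinner_add_left cinner_add_right cinner_bop_adj)

lemma bop_adj_diff: "bop_adj (S - T) = bop_adj S - bop_adj T"
  by (rule bop_adj_eqI) (simp add: cinner_diff_left cinner_diff_right cinner_bop_adj)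

lemma bop_adj_scaleR: "bop_adj (r *\<^sub>R T) = r *\<^sub>R bop_adj T"
  by (rule bop_adj_eqI) (simp add: cinner_scaleR_left cinner_scaleR_right cinner_bop_adj)

lemma bop_adj_prod_list: "bop_adj (prod_list Ts) = prod_list (map bop_adj (rev Ts))"
  by (induction Ts) (simp_all add: bop_adj_mult)

section \<open>Invertible operators\<close>

lemma bop_inv_eqI:
  assumes "T * T' = 1" "T' * T = 1"
  shows "bop_inv T = T'"
  unfolding bop_inv_def
proof (rule the_equality)
  fix U assume U: "T * U = 1 \<and> U * T = 1"
  then have "U = T' * T * U" using assms by simp
  also have "\<dots> = T'" using U by (simp add: mult.assoc)
  finally show "U = T'" .
qed (use assms in simp)

lemma bop_invertibleI: "T * T' = 1 \<Longrightarrow> T' * T = 1 \<Longrightarrow> bop_invertible T"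
  unfolding bop_invertible_def by blast

lemma bop_inv_right: "bop_invertible T \<Longrightarrow> T * bop_inv T = 1"
  and bop_inv_left: "bop_invertible T \<Longrightarrow> bop_inv T * T = 1"
  unfolding bop_invertible_def using bop_inv_eqI by metis+

lemma bop_invertible_inv: "bop_invertible T \<Longrightarrow> bop_invertible (bop_inv T)"
  by (rule bop_invertibleI[of _ T]) (simp_all add: bop_inv_right bop_inv_left)

lemma bop_invertible_one [simp]: "bop_invertible 1"
  by (rule bop_invertibleI[of _ 1]) simp_all

text \<open>One-sided on purpose: applied once in each order, it yields two-sided inverses of
  products.\<close>

lemma bop_mult_inverse:
  fixes S T S' T' :: "'a::chilbert_space bop"
  assumes "S * S' = 1" "T * T' = 1"
  shows "S * T * (T' * S') = 1"
  using assms by (metis mult.assoc mult.right_neutral)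

lemma bop_invertible_mult: "bop_invertible S \<Longrightarrow> bop_invertible T \<Longrightarrow> bop_invertible (S * T)"
  unfolding bop_invertible_def by (meson bop_mult_inverse)

lemma bop_inv_mult:
  "bop_invertible S \<Longrightarrow> bop_invertible T \<Longrightarrow> bop_inv (S * T) = bop_inv T * bop_inv S"
  by (rule bop_inv_eqI) (simp_all add: bop_mult_inverse bop_inv_right bop_inv_left)

lemma bop_adj_inverse: "S * T = 1 \<Longrightarrow> bop_adj T * bop_adj S = 1"
  by (metis bop_adj_mult bop_adj_one)

lemma bop_invertible_adj: "bop_invertible T \<Longrightarrow> bop_invertible (bop_adj T)"
  unfolding bop_invertible_def by (meson bop_adj_inverse)

lemma bop_inv_adj: "bop_invertible T \<Longrightarrow> bop_inv (bop_adj T) = bop_adj (bop_inv T)"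
  by (rule bop_inv_eqI) (simp_all add: bop_adj_inverse bop_inv_right bop_inv_left)

lemma bop_invertible_prod_list:
  "(\<And>T. T \<in> set Ts \<Longrightarrow> bop_invertible T) \<Longrightarrow> bop_invertible (prod_list Ts)"
  by (induction Ts) (simp_all add: bop_invertible_mult)

section \<open>Square roots\<close>

text \<open>Completeness is what the fixed-point construction of square roots rests on. The limit is
  formed pointwise, and the Cauchy estimate makes the convergence uniform on bounded sets.\<close>

instance bop :: (chilbert_space) banach
proof
  fix X :: "nat \<Rightarrow> 'a bop"
  assume X: "Cauchy X"
  have dist: "dist S T = dist (blinfun_of_bop S) (blinfun_of_bop T)" for S T :: "'a bop"
    unfolding dist_norm by transfer simp
  have pointwise: "convergent (\<lambda>n. bop_apply (X n) x)" for x
  proof (rule Cauchy_convergent, rule metric_CauchyI)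
    fix e :: real assume e: "0 < e"
    \<comment> \<open>The summand 1 keeps the denominator positive for \<open>x = 0\<close>.\<close>
    then obtain M where M: "\<And>m n. M \<le> m \<Longrightarrow> M \<le> n \<Longrightarrow> dist (X m) (X n) < e / (norm x + 1)"
      using metric_CauchyD[OF X, of "e / (norm x + 1)"] by (auto simp: add_nonneg_pos)
    have "dist (bop_apply (X m) x) (bop_apply (X n) x) < e" if "M \<le> m" "M \<le> n" for m n
    proof -
      have "dist (bop_apply (X m) x) (bop_apply (X n) x) \<le> dist (X m) (X n) * norm x"
        using norm_bop_apply_le[of "X m - X n" x] by (simp add: dist_norm)
      also have "\<dots> \<le> dist (X m) (X n) * (norm x + 1)" by (simp add: mult_left_mono)
      also have "\<dots> < e" using M[OF that] by (simp add: pos_less_divide_eq add_nonneg_pos)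
      finally show ?thesis .
    qed
    then show "\<exists>M. \<forall>m\<ge>M. \<forall>n\<ge>M. dist (bop_apply (X m) x) (bop_apply (X n) x) < e" by blast
  qed
  then obtain L where L: "\<And>x. (\<lambda>n. bop_apply (X n) x) \<longlonglongrightarrow> L x"
    unfolding convergent_def by metis
  \<comment> \<open>Letting the second index of the Cauchy estimate tend to infinity gives a bound
    relative to \<open>norm x\<close>, with one \<open>N\<close> for all \<open>x\<close>; this
    serves both for the boundedness of \<open>L\<close> and for convergence in norm.\<close>
  have tail: "\<exists>N. \<forall>m\<ge>N. \<forall>x. norm (bop_apply (X m) x - L x) \<le> e * norm x" if e: "0 < e" for e
  proof -
    obtain N where N: "\<And>m n. N \<le> m \<Longrightarrow> N \<le> n \<Longrightarrow> dist (X m) (X n) < e"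
      using metric_CauchyD[OF X e] by meson
    have "norm (bop_apply (X m) x - L x) \<le> e * norm x" if m: "N \<le> m" for m x
    proof (rule LIMSEQ_le_const2)
      show "(\<lambda>n. norm (bop_apply (X m) x - bop_apply (X n) x)) \<longlonglongrightarrow> norm (bop_apply (X m) x - L x)"
        by (intro tendsto_intros L)
      have "norm (bop_apply (X m) x - bop_apply (X n) x) \<le> e * norm x" if "N \<le> n" for n
      proof -
        have "norm (bop_apply (X m) x - bop_apply (X n) x) \<le> norm (X m - X n) * norm x"
          using norm_bop_apply_le[of "X m - X n" x] by simp
        also have "\<dots> \<le> e * norm x"
          using N[OF m that] by (intro mult_right_mono) (simp_all add: dist_norm)
        finally show ?thesis .
      qed
      then show "\<exists>N. \<forall>n\<ge>N. norm (bop_apply (X m) x - bop_apply (X n) x) \<le> e * norm x" by blast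
    qed
    then show ?thesis by blast
  qed
  obtain N where N: "\<And>x. norm (bop_apply (X N) x - L x) \<le> 1 * norm x"
    using tail[of 1] by auto
  have "\<exists>T. \<forall>x. bop_apply T x = L x"
  proof (rule bop_of_bounded_linear[where K = "norm (X N) + 1"])
    show "L (x + y) = L x + L y" for x y
      using LIMSEQ_unique[OF L[of "x + y"]] tendsto_add[OF L[of x] L[of y]] by simp
    show "L (c *\<^sub>C x) = c *\<^sub>C L x" for c x
      using LIMSEQ_unique[OF L[of "c *\<^sub>C x"]]
        bounded_linear.tendsto[OF bounded_linear_scaleC[of c] L[of x]] by simp
    show "norm (L x) \<le> (norm (X N) + 1) * norm x" for x
    proof -
      have "norm (L x) \<le> norm (bop_apply (X N) x) + norm (bop_apply (X N) x - L x)"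
        by norm
      also have "\<dots> \<le> norm (X N) * norm x + 1 * norm x"
        by (intro add_mono norm_bop_apply_le N)
      finally show ?thesis by (simp add: algebra_simps)
    qed
  qed
  then obtain T where T: "\<And>x. bop_apply T x = L x" by blast
  have "X \<longlonglongrightarrow> T"
  proof (rule metric_LIMSEQ_I)
    fix r :: real assume r: "0 < r"
    obtain M where M: "\<And>m x. M \<le> m \<Longrightarrow> norm (bop_apply (X m) x - L x) \<le> r / 2 * norm x"
      using tail[of "r / 2"] r by auto
    have "dist (X m) T \<le> r / 2" if "M \<le> m" for m
      unfolding dist_norm using r M[OF that] by (intro norm_bop_bound) (simp_all add: T)
    then show "\<exists>M. \<forall>m\<ge>M. dist (X m) T < r"
      using r by (intro exI[of _ M]) fastforce
  qed
  then show "convergent X" by (rule convergentI)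
qed

text \<open>Makes the adjoint continuous, so that self-adjointness passes to norm limits.\<close>

lemma norm_bop_adj_le: "norm (bop_adj T) \<le> norm T"
proof (rule norm_bop_bound)
  fix x
  show "norm (bop_apply (bop_adj T) x) \<le> norm T * norm x"
  proof (cases "bop_apply (bop_adj T) x = 0")
    case False
    let ?y = "bop_apply (bop_adj T) x"
    have "(norm ?y)\<^sup>2 = cmod (cinner (bop_apply T ?y) x)"
      by (simp add: cinner_bop_adj cinner_self norm_power)
    also have "\<dots> \<le> norm (bop_apply T ?y) * norm x" by (rule complex_Cauchy_Schwarz)
    also have "\<dots> \<le> norm T * norm ?y * norm x"
      by (intro mult_right_mono norm_bop_apply_le) simp
    finally show ?thesis using False by (simp add: power2_eq_square)
  qed simp
qed simp

lemma bounded_linear_bop_adj: "bounded_linear bop_adj"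
  by (rule bounded_linear_intro[where K = 1])
    (simp_all add: bop_adj_add bop_adj_scaleR norm_bop_adj_le)

text \<open>The root is \<open>1 - X\<close>, where \<open>X\<close> is the fixed point of the contraction
  \<open>X \<mapsto> (1 - A + X\<^sup>2) / 2\<close>; this map preserves the commutant conditions, so \<open>X\<close> satisfies them.\<close>

lemma bop_sqrt_near_one:
  fixes A :: "'a::chilbert_space bop"
  assumes adj: "bop_adj A = A" and b: "norm (1 - A) \<le> b" "b < 1"
  shows "\<exists>R. R * R = A \<and> bop_adj R = R \<and> (\<forall>C. C * A = A * C \<longrightarrow> C * R = R * C) \<and>
    (\<forall>x. (1 - b) * (norm x)\<^sup>2 \<le> Re (cinner (bop_apply R x) x))"
proof -
  \<comment> \<open>The conditions on commuting with \<open>C\<close> are carried along for the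
    uniqueness of the positive root later; self-adjointness makes its quadratic form real.\<close>
  define F where
    "F = {X. norm X \<le> b \<and> bop_adj X = X \<and> (\<forall>C. C * A = A * C \<longrightarrow> C * X = X * C)}"
  define f where "f X = (1/2) *\<^sub>R (1 - A + X * X)" for X
  have b0: "0 \<le> b" using b norm_ge_zero order_trans by blast
  have "closed F"
    unfolding closed_sequential_limits
  proof clarify
    fix X l assume X: "\<forall>n. X n \<in> F" "X \<longlonglongrightarrow> l"
    have "norm (X n) \<le> b" "bop_adj (X n) = X n" for n using X(1) unfolding F_def by blast+
    have "norm l \<le> b"
      by (rule LIMSEQ_le_const2[OF tendsto_norm[OF X(2)]]) (use \<open>norm (X _) \<le> b\<close> in auto)
    moreover have "bop_adj l = l"
      using LIMSEQ_unique[OF bounded_linear.tendsto[OF bounded_linear_bop_adj X(2)]] X(2)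
      by (simp add: \<open>bop_adj (X _) = X _\<close>)
    moreover have "C * l = l * C" if "C * A = A * C" for C
    proof (rule LIMSEQ_unique)
      show "(\<lambda>n. C * X n) \<longlonglongrightarrow> C * l" by (intro tendsto_intros X)
      have "C * X n = X n * C" for n using X(1) that unfolding F_def by blast
      then show "(\<lambda>n. C * X n) \<longlonglongrightarrow> l * C"
        using tendsto_mult[OF X(2) tendsto_const[of C]] by simp
    qed
    ultimately show "l \<in> F" by (simp add: F_def)
  qed
  then have "complete F" by (simp add: complete_eq_closed)
  moreover have "F \<noteq> {}"
  proof -
    have "0 \<in> F" using b0 bop_adj_scaleR[of 0 0] by (simp add: F_def)
    then show ?thesis by blast
  qed
  moreover have "f ` F \<subseteq> F"
  proof clarify
    fix X assume "X \<in> F"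
    then have X: "norm X \<le> b" "bop_adj X = X" "\<And>C. C * A = A * C \<Longrightarrow> C * X = X * C"
      unfolding F_def by blast+
    \<comment> \<open>The ball of radius \<open>b\<close> is mapped into itself because
      \<open>b * b \<le> b\<close>.\<close>
    have "norm (f X) \<le> 1/2 * (b + b * b)"
    proof -
      have "norm (X * X) \<le> b * b"
        using X(1) b0 by (intro order_trans[OF norm_mult_ineq] mult_mono) auto
      then have "norm (1 - A + X * X) \<le> b + b * b"
        by (intro order_trans[OF norm_triangle_ineq] add_mono b)
      then show ?thesis by (simp add: f_def)
    qed
    also have "\<dots> \<le> b" using mult_left_le[of b b] b0 b(2) by simp
    finally have "norm (f X) \<le> b" .
    moreover have "bop_adj (f X) = f X"
      by (simp add: X(2) f_def bop_adj_scaleR bop_adj_add bop_adj_diff bop_adj_mult adj)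
    moreover have "C * f X = f X * C" if C: "C * A = A * C" for C
    proof -
      have CX: "C * X = X * C" using C by (rule X(3))
      have "C * (X * X) = X * X * C" by (metis CX mult.assoc)
      then show ?thesis by (simp add: f_def C left_diff_distrib right_diff_distrib distrib_left distrib_right)
    qed
    ultimately show "f X \<in> F" by (simp add: F_def)
  qed
  moreover have "dist (f X) (f Y) \<le> b * dist X Y" if "X \<in> F" "Y \<in> F" for X Y
  proof -
    have "f X - f Y = (1/2) *\<^sub>R (X * X - Y * Y)"
      by (simp add: f_def flip: scaleR_diff_right)
    \<comment> \<open>This splitting needs no commutation of \<open>X\<close> and \<open>Y\<close>;
      each summand contributes \<open>b\<close> and the factor 1/2 averages them.\<close>
    also have "X * X - Y * Y = X * (X - Y) + (X - Y) * Y"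
      by (simp add: left_diff_distrib right_diff_distrib)
    finally have "f X - f Y = (1/2) *\<^sub>R (X * (X - Y) + (X - Y) * Y)" .
    moreover have "norm (X * (X - Y)) \<le> b * norm (X - Y)"
      using that by (intro order_trans[OF norm_mult_ineq] mult_right_mono) (auto simp: F_def)
    moreover have "norm ((X - Y) * Y) \<le> norm (X - Y) * b"
      using that by (intro order_trans[OF norm_mult_ineq] mult_left_mono) (auto simp: F_def)
    moreover have "norm (X * (X - Y) + (X - Y) * Y) \<le> norm (X * (X - Y)) + norm ((X - Y) * Y)"
      by (rule norm_triangle_ineq)
    ultimately show ?thesis by (simp add: dist_norm mult.commute)
  qed
  ultimately obtain X where "X \<in> F" and fX: "f X = X"
    using Banach_fix[of F b f] b0 b(2) by blast
  then have X: "norm X \<le> b" "bop_adj X = X" "\<And>C. C * A = A * C \<Longrightarrow> C * X = X * C"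
    unfolding F_def by blast+
  have "2 *\<^sub>R f X = 2 *\<^sub>R X" by (simp add: fX)
  then have XX: "X + X = 1 - A + X * X" by (simp add: f_def scaleR_2)
  \<comment> \<open>The fixed-point equation is the expansion of
    \<open>(1 - X) * (1 - X) = A\<close>.\<close>
  have "X * X = X + X - 1 + A" by (simp only: XX) simp
  then have "(1 - X) * (1 - X) = A"
    by (simp add: left_diff_distrib right_diff_distrib)
  moreover have "bop_adj (1 - X) = 1 - X" by (simp add: bop_adj_diff X(2))
  moreover have "C * (1 - X) = (1 - X) * C" if "C * A = A * C" for C
    using X(3)[OF that] by (simp add: left_diff_distrib right_diff_distrib)
  moreover have "(1 - b) * (norm x)\<^sup>2 \<le> Re (cinner (bop_apply (1 - X) x) x)" for x
  proof -
    have "Re (cinner (bop_apply X x) x) \<le> norm (bop_apply X x) * norm x"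
      using complex_Re_le_cmod complex_Cauchy_Schwarz order_trans by blast
    also have "\<dots> \<le> b * norm x * norm x"
      using X(1) by (intro mult_right_mono order_trans[OF norm_bop_apply_le]) auto
    finally show ?thesis
      by (simp add: cinner_diff_left cinner_self power2_eq_square left_diff_distrib)
  qed
  ultimately show ?thesis by blast
qed

text \<open>The root of \<open>t *\<^sub>R A\<close> is scaled back by \<open>1 / sqrt t\<close>.
  Uniqueness among positive roots combines commutation with the strict positivity of this particular
  root.\<close>

lemma bop_sqrt_power2:
  fixes A :: "'a::chilbert_space bop"
  assumes adj: "bop_adj A = A" and t: "0 < t" "norm (1 - t *\<^sub>R A) < 1"
  shows "(bop_sqrt A)\<^sup>2 = A"
proof -
  define b where "b = norm (1 - t *\<^sub>R A)"
  have "bop_adj (t *\<^sub>R A) = t *\<^sub>R A" by (simp add: bop_adj_scaleR adj)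
  then obtain Q where Q: "Q * Q = t *\<^sub>R A" "bop_adj Q = Q"
    "\<And>C. C * (t *\<^sub>R A) = (t *\<^sub>R A) * C \<Longrightarrow> C * Q = Q * C"
    "\<And>x. (1 - b) * (norm x)\<^sup>2 \<le> Re (cinner (bop_apply Q x) x)"
    using bop_sqrt_near_one[OF _ order_refl t(2)] unfolding b_def by blast
  define R where "R = (1 / sqrt t) *\<^sub>R Q"
  have RR: "R * R = A" using t by (simp add: R_def Q(1))
  have R_pos: "0 \<le> Re (cinner (bop_apply R x) x)" for x
    using Q(4)[of x] t by (simp add: R_def cinner_scaleR_left b_def order_trans[rotated])
  have R_definite: "x = 0" if "Re (cinner (bop_apply R x) x) \<le> 0" for x
  proof -
    have "Re (cinner (bop_apply Q x) x) \<le> 0"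
      using that t by (simp add: R_def cinner_scaleR_left mult_le_0_iff divide_le_0_iff)
    then have "(1 - b) * (norm x)\<^sup>2 \<le> 0" using Q(4)[of x] by linarith
    then show ?thesis using t by (simp add: b_def mult_le_0_iff)
  qed
  have "cinner (bop_apply R x) x \<in> \<real>" for x
  proof -
    have "cinner (bop_apply Q x) x = cnj (cinner (bop_apply Q x) x)"
      by (metis Q(2) cinner_bop_adj cinner_commute)
    then show ?thesis by (simp add: R_def cinner_scaleR_left Reals_cnj_iff)
  qed
  then have "bop_positive R"
    unfolding bop_positive_def
    using R_pos by (simp add: complex_nonneg_Reals_iff complex_is_Real_iff)
  moreover have "U = R" if U: "bop_positive U" "U * U = A" for U
  proof (rule bop_eqI)
    fix x
    \<comment> \<open>Any root of \<open>A\<close> commutes with \<open>A\<close>, hence with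
      \<open>R\<close>; therefore \<open>(R + U) * (R - U)\<close> is a difference of
      squares.\<close>
    have "U * (t *\<^sub>R A) = (t *\<^sub>R A) * U" using U by (simp add: mult.assoc flip: U(2))
    then have comm: "U * R = R * U" by (simp add: R_def Q(3))
    define y where "y = bop_apply (R - U) x"
    have "(R + U) * (R - U) = 0"
      by (simp add: algebra_simps comm RR U)
    then have "bop_apply (R + U) y = 0" unfolding y_def by (metis bop_apply_simps(1,8))
    then have "cinner (bop_apply R y) y + cinner (bop_apply U y) y = 0"
      by (metis bop_apply_simps(2) cinner_add_left cinner_zero_left)
    \<comment> \<open>Two nonnegative numbers with sum zero: the form of \<open>R\<close> vanishes
      at \<open>y\<close>, and \<open>R\<close> is definite.\<close>
    then have "Re (cinner (bop_apply R y) y) + Re (cinner (bop_apply U y) y) = 0"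
      by (metis plus_complex.sel(1) zero_complex.sel(1))
    moreover have "0 \<le> Re (cinner (bop_apply U y) y)"
      using U(1) by (simp add: bop_positive_def complex_nonneg_Reals_iff)
    ultimately have "y = 0" by (intro R_definite) linarith
    then show "bop_apply U x = bop_apply R x" by (simp add: y_def)
  qed
  ultimately have "bop_sqrt A = R"
    unfolding bop_sqrt_def using RR by (intro the_equality) blast+
  then show ?thesis by (simp add: power2_eq_square RR)
qed

text \<open>Invertibility bounds \<open>T\<close> from below by \<open>1 / K\<close>. Expanding
  \<open>norm (x - t *\<^sub>R bop_apply A x)\<close> squared gives at most the factor
  \<open>1 - 2 * t / K\<^sup>2 + t\<^sup>2 * M\<^sup>2\<close>, which is below 1 for small
  \<open>t\<close>.\<close>

lemma bop_abs_power2: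
  assumes "bop_invertible T"
  shows "(bop_abs T)\<^sup>2 = bop_adj T * T"
proof -
  define A where "A = bop_adj T * T"
  \<comment> \<open>Adding 1 keeps \<open>K\<close> and \<open>M\<close> at least 1, also on the
    zero space, where the norms are 0.\<close>
  define K where "K = norm (bop_inv T) + 1"
  define M where "M = norm A + 1"
  \<comment> \<open>This \<open>t\<close> minimizes the quadratic factor, and \<open>b\<close> is
    the square root of the minimum.\<close>
  define t where "t = 1 / (K * M)\<^sup>2"
  define b where "b = sqrt (1 - 1 / (K\<^sup>2 * M)\<^sup>2)"
  have KM: "1 \<le> K" "1 \<le> M" by (simp_all add: K_def M_def)
  then have "1 \<le> (K\<^sup>2 * M)\<^sup>2"
    using mult_mono[of 1 "K\<^sup>2" 1 M] by (simp add: one_le_power)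
  then have b: "b < 1" "b\<^sup>2 = 1 - 1 / (K\<^sup>2 * M)\<^sup>2" "0 \<le> b"
    using KM by (auto simp: b_def)
  have "norm (1 - t *\<^sub>R A) \<le> b"
  proof (rule norm_bop_bound[OF b(3)])
    fix x
    have "norm x = norm (bop_apply (bop_inv T) (bop_apply T x))"
      using assms by (metis bop_apply_simps(7,8) bop_inv_left)
    also have "\<dots> \<le> norm (bop_inv T) * norm (bop_apply T x)" by (rule norm_bop_apply_le)
    also have "\<dots> \<le> K * norm (bop_apply T x)" by (simp add: K_def mult_right_mono)
    finally have "(norm x)\<^sup>2 \<le> (K * norm (bop_apply T x))\<^sup>2" by (simp add: power_mono)
    then have lower: "(norm x)\<^sup>2 / K\<^sup>2 \<le> (norm (bop_apply T x))\<^sup>2"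
      using KM by (simp add: power_mult_distrib divide_le_eq mult.commute)
    have "norm (bop_apply A x) \<le> M * norm x"
      by (rule order_trans[OF norm_bop_apply_le]) (simp add: M_def mult_right_mono)
    then have upper: "(norm (bop_apply A x))\<^sup>2 \<le> M\<^sup>2 * (norm x)\<^sup>2"
      by (metis norm_ge_zero power_mono power_mult_distrib)
    have "cinner x (bop_apply A x) = cinner (bop_apply T x) (bop_apply T x)"
      by (simp add: A_def cinner_bop_adj)
    then have "(norm (bop_apply (1 - t *\<^sub>R A) x))\<^sup>2
        = (norm x)\<^sup>2 - 2 * t * (norm (bop_apply T x))\<^sup>2 + t\<^sup>2 * (norm (bop_apply A x))\<^sup>2"
      using norm_sq_add[of x "- (t *\<^sub>R bop_apply A x)"]
      by (simp add: cinner_scaleR_right cinner_self power_mult_distrib)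
    also have "\<dots> \<le> (norm x)\<^sup>2 - 2 * t * ((norm x)\<^sup>2 / K\<^sup>2) + t\<^sup>2 * (M\<^sup>2 * (norm x)\<^sup>2)"
      by (intro add_mono diff_mono mult_left_mono lower upper order_refl) (simp_all add: t_def)
    also have "\<dots> = (b * norm x)\<^sup>2"
      using KM by (simp add: t_def b power_mult_distrib field_simps flip: power_mult power_add)
    finally show "norm (bop_apply (1 - t *\<^sub>R A) x) \<le> b * norm x"
      by (rule power2_le_imp_le) (simp add: b)
  qed
  moreover have "0 < t" using KM by (simp add: t_def)
  moreover have "bop_adj A = A" by (simp add: A_def bop_adj_mult)
  ultimately show ?thesis
    unfolding bop_abs_def A_def[symmetric] using b(1) by (intro bop_sqrt_power2) auto
qed

section \<open>Operator polynomials and finite differences\<close>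

text \<open>Induction on the exponent: one factor \<open>z + k\<close> is split off, and the part
  with \<open>k\<close> is absorbed by \<open>k * (m choose k) = m * (m - 1 choose k - 1)\<close>.
  That shifts the base point, so \<open>z\<close> must stay arbitrary.\<close>

lemma alternating_binomial_sum_power:
  fixes z :: "'b::comm_ring_1"
  assumes "j < m"
  shows "(\<Sum>k=0..m. of_nat (m choose k) * (-1) ^ (m - k) * (z + of_nat k) ^ j) = 0"
  using assms
proof (induction j arbitrary: m z)
  case 0
  have "(\<Sum>k=0..m. of_nat (m choose k) * (-1) ^ (m - k)) = (1 + (-1 :: 'b)) ^ m"
    unfolding binomial_ring by (simp add: atLeast0AtMost)
  with 0 show ?case by (simp add: zero_power)
next
  case (Suc j)
  then obtain n where m: "m = Suc n" "j < n" by (cases m) auto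
  have "(\<Sum>k=0..m. of_nat (m choose k) * (-1) ^ (m - k) * (z + of_nat k) ^ Suc j)
      = z * (\<Sum>k=0..m. of_nat (m choose k) * (-1) ^ (m - k) * (z + of_nat k) ^ j)
        + (\<Sum>k=0..m. of_nat (k * (m choose k)) * (-1) ^ (m - k) * (z + of_nat k) ^ j)"
    unfolding sum_distrib_left sum.distrib[symmetric]
    by (intro sum.cong refl) (simp add: algebra_simps)
  also have "(\<Sum>k=0..m. of_nat (m choose k) * (-1) ^ (m - k) * (z + of_nat k) ^ j) = 0"
    using Suc.prems by (intro Suc.IH) simp
  also have "(\<Sum>k=0..m. of_nat (k * (m choose k)) * (-1) ^ (m - k) * (z + of_nat k) ^ j)
      = (\<Sum>k=0..n. of_nat (Suc k * (Suc n choose Suc k)) * (-1) ^ (n - k) * (z + of_nat (Suc k)) ^ j)"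
    unfolding m by (subst sum.atLeast0_atMost_Suc_shift)
      (simp del: binomial_Suc_Suc mult_Suc of_nat_Suc)
  also have "\<dots> = of_nat (Suc n) *
      (\<Sum>k=0..n. of_nat (n choose k) * (-1) ^ (n - k) * ((z + 1) + of_nat k) ^ j)"
    unfolding sum_distrib_left Suc_times_binomial
    by (intro sum.cong refl) (simp add: algebra_simps)
  also have "(\<Sum>k=0..n. of_nat (n choose k) * (-1) ^ (n - k) * ((z + 1) + of_nat k) ^ j) = 0"
    using m(2) by (rule Suc.IH)
  finally show ?case by simp
qed

section \<open>Differences and interpolation of operator polynomials\<close>

lemma scaleC_zero_left [simp]: "0 *\<^sub>C x = (0 :: 'b::complex_vector)"
  using scaleR_scaleC[of 0 x] by simp

lemma scaleC_one [simp]: "1 *\<^sub>C x = (x :: 'b::complex_vector)"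
  using scaleR_scaleC[of 1 x] by simp

lemma scaleC_zero_right [simp]: "c *\<^sub>C 0 = (0 :: 'b::complex_vector)"
  using scaleC_add_right[of c 0 "0 :: 'b"] by simp

lemma scaleC_sum_left: "sum f F *\<^sub>C x = (\<Sum>i\<in>F. f i *\<^sub>C (x :: 'b::complex_vector))"
  by (induction F rule: infinite_finite_induct) (simp_all add: scaleC_add_left)

lemma scaleC_sum_right: "c *\<^sub>C sum f F = (\<Sum>i\<in>F. c *\<^sub>C (f i :: 'b::complex_vector))"
  by (induction F rule: infinite_finite_induct) (simp_all add: scaleC_add_right)

lemma bop_polys_difference:
  fixes f :: "complex \<Rightarrow> 'a::chilbert_space bop"
  assumes "f \<in> bop_polys n" "n < m"
  shows "(\<Sum>k=0..m. (real (m choose k) * (-1) ^ (m - k)) *\<^sub>R f (z + of_nat k)) = 0"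
proof -
  obtain A where A: "\<And>z. f z = (\<Sum>j=0..n. z ^ j *\<^sub>C A j)"
    using assms(1) unfolding bop_polys_def by blast
  have "(\<Sum>k=0..m. (real (m choose k) * (-1) ^ (m - k)) *\<^sub>R f (z + of_nat k))
      = (\<Sum>k=0..m. \<Sum>j=0..n. (of_nat (m choose k) * (-1) ^ (m - k) * (z + of_nat k) ^ j) *\<^sub>C A j)"
    unfolding A scaleR_scaleC scaleC_sum_right scaleC_scaleC by simp
  also have "\<dots> = (\<Sum>j=0..n. (\<Sum>k=0..m. of_nat (m choose k) * (-1) ^ (m - k) * (z + of_nat k) ^ j) *\<^sub>C A j)"
    unfolding scaleC_sum_left by (rule sum.swap)
  also have "\<dots> = 0"
    using assms(2) by (intro sum.neutral ballI) (simp add: alternating_binomial_sum_power)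
  finally show ?thesis .
qed

lemma bop_polys_mono:
  assumes "n \<le> n'"
  shows "bop_polys n \<subseteq> bop_polys n'"
proof
  fix f :: "complex \<Rightarrow> 'a bop" assume "f \<in> bop_polys n"
  then obtain A where A: "\<And>z. f z = (\<Sum>j=0..n. z ^ j *\<^sub>C A j)"
    unfolding bop_polys_def by blast
  have "f z = (\<Sum>j=0..n'. z ^ j *\<^sub>C (if j \<le> n then A j else 0))" for z
    unfolding A using assms by (intro sum.mono_neutral_cong_left) auto
  then show "f \<in> bop_polys n'" unfolding bop_polys_def
    by (auto intro!: exI[of _ "\<lambda>j. if j \<le> n then A j else 0"])
qed

lemma bop_polys_add:
  assumes "f \<in> bop_polys n" "g \<in> bop_polys n"
  shows "(\<lambda>z. f z + g z) \<in> bop_polys n"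
proof -
  obtain A B where "\<And>z. f z = (\<Sum>j=0..n. z ^ j *\<^sub>C A j)" "\<And>z. g z = (\<Sum>j=0..n. z ^ j *\<^sub>C B j)"
    using assms unfolding bop_polys_def by blast
  then have "\<forall>z. f z + g z = (\<Sum>j=0..n. z ^ j *\<^sub>C (A j + B j))"
    by (simp add: scaleC_add_right sum.distrib)
  then show ?thesis
    unfolding bop_polys_def by (intro CollectI exI[of _ "\<lambda>j. A j + B j"])
qed

lemma bop_polys_poly:
  assumes "degree c \<le> n"
  shows "(\<lambda>z. poly c z *\<^sub>C B) \<in> bop_polys n"
proof -
  have "(\<lambda>z. poly c z *\<^sub>C B) \<in> bop_polys (degree c)"
    unfolding bop_polys_def mem_Collect_eq
    by (rule exI[of _ "\<lambda>j. coeff c j *\<^sub>C B"])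
      (simp add: poly_altdef scaleC_sum_left scaleC_scaleC mult.commute atLeast0AtMost)
  then show ?thesis using bop_polys_mono[OF assms] by blast
qed

text \<open>Newton interpolation: a new node is met by adding an operator multiple of a scalar
  polynomial that vanishes at all earlier nodes.\<close>

lemma bop_polys_interpolation:
  fixes g :: "nat \<Rightarrow> 'a::chilbert_space bop"
  shows "\<exists>q \<in> bop_polys n. \<forall>i\<le>n. q (of_nat i) = g i"
proof (induction n)
  case 0
  have "(\<lambda>z. poly 1 z *\<^sub>C g 0) \<in> bop_polys 0" by (rule bop_polys_poly) simp
  then show ?case by (rule bexI[rotated]) simp
next
  case (Suc n)
  then obtain q where q: "q \<in> bop_polys n" "\<And>i. i \<le> n \<Longrightarrow> q (of_nat i) = g i" by blast
  define c :: "complex poly" where "c = (\<Prod>i\<in>{..n}. [:- of_nat i, 1:])"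
  define B where "B = (1 / poly c (of_nat (Suc n))) *\<^sub>C (g (Suc n) - q (of_nat (Suc n)))"
  have root: "poly c (of_nat i) = 0" if "i \<le> n" for i
    using that by (auto simp: c_def poly_prod)
  have "poly c (of_nat (Suc n)) = (\<Prod>i\<in>{..n}. of_nat (Suc n) - of_nat i)"
    by (simp add: c_def poly_prod)
  also have "\<dots> \<noteq> 0"
    by (simp only: prod_zero_iff finite_atMost right_minus_eq of_nat_eq_iff) auto
  finally have c: "poly c (of_nat (Suc n)) \<noteq> 0" .
  have "degree c = Suc n" unfolding c_def by (subst degree_prod_eq_sum_degree) auto
  then have "(\<lambda>z. q z + poly c z *\<^sub>C B) \<in> bop_polys (Suc n)"
    using q(1) bop_polys_mono[of n "Suc n"] by (intro bop_polys_add bop_polys_poly) auto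
  moreover have "q (of_nat i) + poly c (of_nat i) *\<^sub>C B = g i" if "i \<le> Suc n" for i
  proof (cases "i = Suc n")
    case True
    then show ?thesis using c by (simp add: B_def scaleC_scaleC del: of_nat_Suc)
  next
    case False
    then show ?thesis using that by (simp add: root q(2))
  qed
  ultimately show ?case by (intro bexI[of _ "\<lambda>z. q z + poly c z *\<^sub>C B"]) simp_all
qed

text \<open>The recurrence has coefficient \<open>1\<close> at \<open>k = m\<close> and
  \<open>(-1) ^ m\<close> at \<open>k = 0\<close>, so it can be solved in either direction, and a
  window of \<open>m\<close> consecutive zeros moves along the integers both ways.\<close>

lemma difference_zero_imp_zero:
  fixes g :: "int \<Rightarrow> 'b::real_vector"
  assumes diff: "\<And>n. (\<Sum>k=0..m. (real (m choose k) * (-1) ^ (m - k)) *\<^sub>R g (n + int k)) = 0"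
    and init: "\<And>k. k < m \<Longrightarrow> g (int k) = 0"
  shows "g n = 0"
proof -
  have last: "g (n + int m) = 0" if "\<And>k. k < m \<Longrightarrow> g (n + int k) = 0" for n
  proof -
    have "(\<Sum>k=0..m. (real (m choose k) * (-1) ^ (m - k)) *\<^sub>R g (n + int k)) = g (n + int m)"
      by (subst sum.remove[of _ m]) (auto intro!: sum.neutral that)
    then show ?thesis using diff by simp
  qed
  have first: "g n = 0" if prev: "\<And>k. k < m \<Longrightarrow> g (n + 1 + int k) = 0" for n
  proof -
    have "(\<Sum>k=0..m. (real (m choose k) * (-1) ^ (m - k)) *\<^sub>R g (n + int k)) = (-1) ^ m *\<^sub>R g n"
    proof (subst sum.remove[of _ 0])
      have "g (n + int k) = 0" if "k \<in> {0..m} - {0}" for k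
      proof (cases k)
        case (Suc i)
        then have "g (n + 1 + int i) = 0" using prev that by simp
        then show ?thesis by (simp add: Suc algebra_simps)
      qed (use that in simp)
      then show "(real (m choose 0) * (-1) ^ (m - 0)) *\<^sub>R g (n + int 0)
          + (\<Sum>k\<in>{0..m} - {0}. (real (m choose k) * (-1) ^ (m - k)) *\<^sub>R g (n + int k))
          = (-1) ^ m *\<^sub>R g n"
        by (simp add: sum.neutral)
    qed auto
    then show ?thesis using diff by simp
  qed
  have "\<forall>k<m. g (n + int k) = 0" for n
  proof (induction n rule: int_induct[where k = 0])
    case base
    then show ?case using init by simp
  next
    case (step1 n)
    have "g (n + 1 + int k) = 0" if "k < m" for k
    proof (cases "Suc k = m")
      case True
      have "g (n + int m) = 0" using step1(2) by (intro last) blast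
      then show ?thesis using True by (auto simp: algebra_simps)
    next
      case False
      then have "g (n + int (Suc k)) = 0" using step1(2) that by (simp del: of_nat_Suc)
      then show ?thesis by (simp add: algebra_simps)
    qed
    then show ?case by blast
  next
    case (step2 n)
    have "g (n - 1 + int k) = 0" if "k < m" for k
    proof (cases k)
      case 0
      have "g (n - 1) = 0" by (rule first) (use step2(2) in simp)
      then show ?thesis using 0 by simp
    next
      case (Suc i)
      then have "g (n + int i) = 0" using step2(2) that by simp
      then show ?thesis by (simp add: Suc)
    qed
    then show ?case by blast
  qed
  \<comment> \<open>For \<open>m = 0\<close> the window is empty and says nothing; then
    \<open>last\<close> gives the claim directly.\<close>
  from this[of n] show ?thesis
    using last[of n] by (cases "m = 0") (auto dest: spec[of _ 0])
qed

text \<open>The interpolant at \<open>0, ..., m - 1\<close> satisfies the same recurrence as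
  \<open>g\<close>, so their difference vanishes on all integers once it vanishes on these
  nodes.\<close>

lemma difference_zero_imp_bop_poly:
  fixes g :: "int \<Rightarrow> 'a::chilbert_space bop"
  assumes "m \<ge> 1"
    and "\<And>n. (\<Sum>k=0..m. (real (m choose k) * (-1) ^ (m - k)) *\<^sub>R g (n + int k)) = 0"
  shows "\<exists>q \<in> bop_polys (m - 1). \<forall>n. q (of_int n) = g n"
proof -
  obtain q where q: "q \<in> bop_polys (m - 1)" "\<And>i. i \<le> m - 1 \<Longrightarrow> q (of_nat i) = g (int i)"
    using bop_polys_interpolation[of "m - 1" "\<lambda>i. g (int i)"] by auto
  have "q (of_int n) - g n = 0" for n
  proof (rule difference_zero_imp_zero[where m = m])
    show "(\<Sum>k=0..m. (real (m choose k) * (-1) ^ (m - k)) *\<^sub>R (q (of_int (n + int k)) - g (n + int k))) = 0" for n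
      using assms bop_polys_difference[OF q(1), of m "of_int n"]
      by (simp add: scaleR_diff_right sum_subtractf)
    show "q (of_int (int k)) - g (int k) = 0" if "k < m" for k
      using that q(2)[of k] by simp
  qed
  then show ?thesis using q(1) by auto
qed

text \<open>Pairing with two fixed vectors turns the product into a scalar polynomial; it takes a
  constant value at infinitely many points.\<close>

lemma bop_polys_mult_eq_one:
  fixes p q :: "complex \<Rightarrow> 'a::chilbert_space bop"
  assumes "p \<in> bop_polys n" "q \<in> bop_polys n'"
    and one: "\<And>k. p (of_nat k) * q (of_nat k) = 1"
  shows "p z * q z = 1"
proof (intro bop_eqI cinner_ext_left)
  fix x y :: 'a
  obtain A B where A: "\<And>z. p z = (\<Sum>i=0..n. z ^ i *\<^sub>C A i)" and B: "\<And>z. q z = (\<Sum>j=0..n'. z ^ j *\<^sub>C B j)"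
    using assms unfolding bop_polys_def by blast
  define c where "c = (\<Sum>i=0..n. \<Sum>j=0..n'.
    monom (cinner (bop_apply (A i) (bop_apply (B j) x)) y) (i + j))"
  have c: "cinner (bop_apply (p z * q z) x) y = poly c z" for z
    unfolding c_def A B
    by (simp add: bop_apply_sum cinner_sum_left cinner_scaleC_left poly_sum poly_monom
        sum_distrib_left power_add mult_ac)
      (subst sum.swap, intro sum.cong refl, simp add: mult_ac)
  have "c - [:cinner x y:] = 0"
  proof (rule ccontr)
    assume "c - [:cinner x y:] \<noteq> 0"
    then have "finite {z. poly (c - [:cinner x y:]) z = 0}" by (rule poly_roots_finite)
    moreover have "poly c (of_nat k) = cinner x y" for k
      using c[of "of_nat k"] by (simp only: one bop_apply_simps)
    then have "range of_nat \<subseteq> {z. poly (c - [:cinner x y:]) z = 0}"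
      by auto
    moreover have "infinite (range (of_nat :: nat \<Rightarrow> complex))"
      by (rule range_inj_infinite) (rule inj_of_nat)
    ultimately show False using finite_subset by blast
  qed
  then show "cinner (bop_apply (p z * q z) x) y = cinner (bop_apply 1 x) y"
    unfolding c by simp
qed

section \<open>Weighted shifts and their adjoints\<close>

lift_definition l2_single :: "int \<Rightarrow> 'a::chilbert_space \<Rightarrow> 'a l2int"
  is "\<lambda>i x j. if j = i then x else 0"
proof -
  fix i :: int and x :: 'a
  have "(\<lambda>j. (norm (if j = i then x else 0))\<^sup>2) summable_on {i}" by simp
  then show "(\<lambda>j. (norm (if j = i then x else 0))\<^sup>2) summable_on UNIV"
    by (rule summable_on_cong_neutral[THEN iffD1, rotated -1]) auto
qed

lemma cinner_l2_single: "cinner (l2_single i x) h = cinner x (l2_nth h i)"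
proof -
  have "cinner (l2_single i x) h = (\<Sum>\<^sub>\<infinity>j. cinner (l2_nth (l2_single i x) j) (l2_nth h j))"
    by (rule cinner_l2int.rep_eq)
  also have "\<dots> = (\<Sum>\<^sub>\<infinity>j\<in>{i}. cinner (l2_nth (l2_single i x) j) (l2_nth h j))"
    by (rule infsum_cong_neutral) (auto simp: l2_single.rep_eq)
  finally show ?thesis by (simp add: l2_single.rep_eq)
qed

lemma l2_nth_sum: "l2_nth (sum f F) i = (\<Sum>k\<in>F. l2_nth (f k) i)"
  by (induction F rule: infinite_finite_induct) (simp_all add: zero_l2int.rep_eq plus_l2int.rep_eq)

lemma bilateral_weighted_shift_nth:
  "bilateral_weighted_shift S W \<Longrightarrow> l2_nth (bop_apply S h) i = bop_apply (W i) (l2_nth h (i - 1))"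
  by (simp add: bilateral_weighted_shift_def)

text \<open>Coordinates are read off by pairing with \<open>l2_single\<close>, and \<open>S\<close>
  merely moves such a vector from \<open>i\<close> to \<open>i + 1\<close>.\<close>

lemma bilateral_weighted_shift_adj_nth:
  assumes "bilateral_weighted_shift S W"
  shows "l2_nth (bop_apply (bop_adj S) h) i = bop_apply (bop_adj (W (i + 1))) (l2_nth h (i + 1))"
proof (rule cinner_ext_right)
  fix x
  have "bop_apply S (l2_single i x) = l2_single (i + 1) (bop_apply (W (i + 1)) x)"
    by (rule l2_nth_eqI) (auto simp: bilateral_weighted_shift_nth[OF assms] l2_single.rep_eq)
  then have "cinner (l2_single i x) (bop_apply (bop_adj S) h)
      = cinner (l2_single (i + 1) (bop_apply (W (i + 1)) x)) h"
    by (simp flip: cinner_bop_adj)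
  then show "cinner x (l2_nth (bop_apply (bop_adj S) h) i)
      = cinner x (bop_apply (bop_adj (W (i + 1))) (l2_nth h (i + 1)))"
    by (simp add: cinner_l2_single cinner_bop_adj)
qed

text \<open>Lists are reversed because the products have decreasing indices. Inverting on the
  negative side lets one recursion hold across 0: \<open>A 0 = W 0 * A (-1)\<close> reads
  \<open>1 = W 0 * bop_inv (W 0)\<close>.\<close>

definition weight_prod :: "(int \<Rightarrow> 'a::chilbert_space bop) \<Rightarrow> int \<Rightarrow> 'a bop"
  where "weight_prod W n =
    (if 0 \<le> n then prod_list (map W (rev [1..n])) else bop_inv (prod_list (map W (rev [n + 1..0]))))"

lemma weight_prod_0 [simp]: "weight_prod W 0 = 1"
  by (simp add: weight_prod_def)

lemma bop_invertible_weight_prod: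
  assumes "\<And>j. bop_invertible (W j)"
  shows "bop_invertible (weight_prod W n)"
proof -
  have "bop_invertible (prod_list (map W js))" for js
    by (rule bop_invertible_prod_list) (auto simp: assms)
  then show ?thesis by (simp add: weight_prod_def bop_invertible_inv)
qed

lemma weight_prod_rec:
  assumes inv: "\<And>j. bop_invertible (W j)"
  shows "weight_prod W n = W n * weight_prod W (n - 1)"
proof (cases "1 \<le> n")
  case True
  then show ?thesis by (simp add: weight_prod_def upto_rec2)
next
  case False
  define B where "B = prod_list (map W (rev [n + 1..0]))"
  have B: "bop_invertible B"
    unfolding B_def by (rule bop_invertible_prod_list) (auto simp: inv)
  \<comment> \<open>At \<open>n = 0\<close> the list is empty, so that the boundary case has the
    same form \<open>bop_inv B\<close> as the negative ones.\<close>
  have "bop_inv 1 = (1 :: 'a bop)" by (rule bop_inv_eqI) simp_all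
  then have "weight_prod W n = bop_inv B"
    using False by (cases "n = 0") (simp_all add: weight_prod_def B_def)
  moreover have "weight_prod W (n - 1) = bop_inv (B * W n)"
    using False by (simp add: weight_prod_def B_def upto_rec1[of n])
  ultimately show ?thesis
    by (simp add: bop_inv_mult B inv bop_inv_right flip: mult.assoc)
qed

text \<open>The product of the weights with indices from \<open>i\<close> down to
  \<open>i - k + 1\<close> telescopes to this quotient.\<close>

lemma shift_power_nth:
  assumes S: "bilateral_weighted_shift S W" and inv: "\<And>j. bop_invertible (W j)"
  shows "l2_nth (bop_apply (S ^ k) h) i
    = bop_apply (weight_prod W i * bop_inv (weight_prod W (i - int k))) (l2_nth h (i - int k))"
proof (induction k arbitrary: i)
  case 0
  then show ?case by (simp add: bop_inv_right bop_invertible_weight_prod inv del: bop_apply_simps(8))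
next
  case (Suc k)
  have "l2_nth (bop_apply (S ^ Suc k) h) i = bop_apply (W i) (l2_nth (bop_apply (S ^ k) h) (i - 1))"
    by (simp add: bilateral_weighted_shift_nth[OF S])
  also have "\<dots> = bop_apply (W i * weight_prod W (i - 1) * bop_inv (weight_prod W (i - 1 - int k)))
      (l2_nth h (i - 1 - int k))"
    by (simp add: Suc)
  also have "W i * weight_prod W (i - 1) = weight_prod W i"
    by (rule weight_prod_rec[OF inv, symmetric])
  finally show ?case by (simp add: algebra_simps)
qed

lemma shift_adj_power_nth:
  assumes S: "bilateral_weighted_shift S W" and inv: "\<And>j. bop_invertible (W j)"
  shows "l2_nth (bop_apply (bop_adj S ^ k) h) i
    = bop_apply (bop_adj (weight_prod W (i + int k) * bop_inv (weight_prod W i))) (l2_nth h (i + int k))"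
proof (induction k arbitrary: i)
  case 0
  then show ?case by (simp add: bop_inv_right bop_invertible_weight_prod inv)
next
  case (Suc k)
  let ?A = "weight_prod W"
  have A: "bop_invertible (?A n)" for n by (rule bop_invertible_weight_prod[OF inv])
  have "bop_inv (?A (i + 1)) * W (i + 1) = bop_inv (?A i)"
  proof -
    have "bop_inv (?A (i + 1)) = bop_inv (?A i) * bop_inv (W (i + 1))"
      using weight_prod_rec[where W = W, OF inv, of "i + 1"] by (simp add: bop_inv_mult inv A)
    then show ?thesis by (simp add: mult.assoc bop_inv_left inv)
  qed
  then have "?A (i + 1 + int k) * bop_inv (?A (i + 1)) * W (i + 1) = ?A (i + 1 + int k) * bop_inv (?A i)"
    by (simp add: mult.assoc)
  moreover have "l2_nth (bop_apply (bop_adj S ^ Suc k) h) i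
      = bop_apply (bop_adj (W (i + 1))) (l2_nth (bop_apply (bop_adj S ^ k) h) (i + 1))"
    by (simp add: bilateral_weighted_shift_adj_nth[OF S])
  then have "l2_nth (bop_apply (bop_adj S ^ Suc k) h) i
      = bop_apply (bop_adj (?A (i + 1 + int k) * bop_inv (?A (i + 1)) * W (i + 1))) (l2_nth h (i + 1 + int k))"
    unfolding Suc by (simp add: bop_adj_mult)
  ultimately show ?case by (simp add: ac_simps)
qed

lemma m_isometric_adj_shift_iff:
  assumes S: "bilateral_weighted_shift S W" and inv: "\<And>j. bop_invertible (W j)"
  shows "m_isometric m (bop_adj S) \<longleftrightarrow>
    (\<forall>n. (\<Sum>k=0..m. (real (m choose k) * (-1) ^ (m - k)) *\<^sub>R
      bop_inv (bop_adj (weight_prod W (n + int k)) * weight_prod W (n + int k))) = 0)"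
proof -
  define A where "A = weight_prod W"
  define G where "G n = bop_inv (bop_adj (A n) * A n)" for n
  define c where "c k = real (m choose k) * (-1) ^ (m - k)" for k
  define D where "D = (\<Sum>k=0..m. c k *\<^sub>R (bop_adj (bop_adj S) ^ k * bop_adj S ^ k))"
  have A: "bop_invertible (A n)" for n
    unfolding A_def by (rule bop_invertible_weight_prod[OF inv])
  have G: "G n = bop_inv (A n) * bop_adj (bop_inv (A n))" for n
    by (simp add: G_def bop_inv_mult bop_inv_adj bop_invertible_adj A)
  \<comment> \<open>The adjoint power carries coordinate \<open>i\<close> to \<open>i - k\<close>
    and the power carries it back; the two inverse factors at \<open>i - k\<close> meet and form
    \<open>G (i - int k)\<close>.\<close>
  have "l2_nth (bop_apply (S ^ k * bop_adj S ^ k) h) i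
      = bop_apply (A i * G (i - int k) * bop_adj (A i)) (l2_nth h i)" for k h i
    by (simp add: shift_power_nth[OF S inv] shift_adj_power_nth[OF S inv] G bop_adj_mult A_def)
  then have D_nth: "l2_nth (bop_apply D h) i
      = bop_apply (A i * (\<Sum>k=0..m. c k *\<^sub>R G (i - int k)) * bop_adj (A i)) (l2_nth h i)" for h i
    unfolding D_def
    by (simp add: bop_apply_sum l2_nth_sum scaleR_l2int.rep_eq del: bop_apply_simps(8))
      (simp add: bop_apply_sum)
  \<comment> \<open>The diagonal entries run through the indices backwards. Reversing the sum costs
    only a sign, by symmetry of the binomial coefficients.\<close>
  have flip: "(\<Sum>k=0..m. c k *\<^sub>R G (n + int m - int k)) = (-1) ^ m *\<^sub>R (\<Sum>k=0..m. c k *\<^sub>R G (n + int k))" for n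
  proof -
    have "(\<Sum>k=0..m. c k *\<^sub>R G (n + int m - int k)) = (\<Sum>k=0..m. c (m - k) *\<^sub>R G (n + int k))"
      by (subst sum.atLeastAtMost_rev) (intro sum.cong refl, simp add: of_nat_diff)
    also have "c (m - k) = (-1) ^ m * c k" if "k \<le> m" for k
    proof -
      have "(-1 :: real) ^ m * (-1) ^ (m - k) = (-1) ^ k"
        using that by (simp add: minus_one_power_iff)
      then show ?thesis using that by (simp add: c_def binomial_symmetric[of k m] mult.left_commute)
    qed
    then have "(\<Sum>k=0..m. c (m - k) *\<^sub>R G (n + int k)) = (-1) ^ m *\<^sub>R (\<Sum>k=0..m. c k *\<^sub>R G (n + int k))"
      by (simp add: scaleR_sum_right)
    finally show ?thesis .
  qed
  have "m_isometric m (bop_adj S) \<longleftrightarrow> D = 0"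
    by (simp add: m_isometric_def D_def c_def)
  also have "\<dots> \<longleftrightarrow> (\<forall>i. (\<Sum>k=0..m. c k *\<^sub>R G (i - int k)) = 0)"
  proof
    assume D: "D = 0"
    show "\<forall>i. (\<Sum>k=0..m. c k *\<^sub>R G (i - int k)) = 0"
    proof
      fix i
      define X where "X = (\<Sum>k=0..m. c k *\<^sub>R G (i - int k))"
      have "A i * X * bop_adj (A i) = 0"
      proof (rule bop_eqI)
        fix x
        show "bop_apply (A i * X * bop_adj (A i)) x = bop_apply 0 x"
          using D_nth[of "l2_single i x" i]
          by (simp add: D X_def l2_single.rep_eq zero_l2int.rep_eq del: bop_apply_simps(8))
      qed
      \<comment> \<open>The sandwich is undone by the inverses of its two outer factors.\<close>
      then have "bop_inv (A i) * (A i * X * bop_adj (A i)) * bop_adj (bop_inv (A i)) = 0"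
        by simp
      moreover have "bop_inv (A i) * (A i * X * bop_adj (A i)) * bop_adj (bop_inv (A i))
          = (bop_inv (A i) * A i) * X * (bop_adj (A i) * bop_adj (bop_inv (A i)))"
        by (simp only: mult.assoc)
      ultimately show "X = 0"
        by (simp add: bop_inv_left A bop_adj_inverse)
    qed
  next
    assume "\<forall>i. (\<Sum>k=0..m. c k *\<^sub>R G (i - int k)) = 0"
    then show "D = 0"
      by (intro bop_eqI l2_nth_eqI) (simp only: D_nth, simp add: zero_l2int.rep_eq)
  qed
  also have "\<dots> \<longleftrightarrow> (\<forall>n. (\<Sum>k=0..m. c k *\<^sub>R G (n + int m - int k)) = 0)"
    by (metis diff_add_cancel)
  also have "\<dots> \<longleftrightarrow> (\<forall>n. (\<Sum>k=0..m. c k *\<^sub>R G (n + int k)) = 0)"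
    by (simp add: flip)
  finally show ?thesis by (simp add: c_def G_def A_def)
qed

theorem theorem4p7:
  fixes m :: nat
    and S :: "'a::chilbert_space l2int bop"
    and W :: "int \<Rightarrow> 'a bop"
    and p :: "complex \<Rightarrow> 'a bop"
  assumes "m \<ge> 1"
    and "bilateral_weighted_shift S W"
    and "\<And>j. bop_invertible (W j)"
    and "m_isometric m S"
    and "p \<in> bop_polys (m - 1)"
    and "p 0 = 1"
    and "\<And>n::int. n \<ge> 1 \<Longrightarrow> p (of_int n) = (bop_abs (prod_list (map W (rev [1..n]))))\<^sup>2"
    and "\<And>n::int. n \<ge> 1 \<Longrightarrow> p (- of_int n) =
           bop_inv ((bop_abs (prod_list (map (\<lambda>i. bop_adj (W i)) [- n + 1..0])))\<^sup>2)"
  shows "m_isometric m (bop_adj S) \<longleftrightarrow>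
    (\<exists>q \<in> bop_polys (m - 1). \<forall>z. p z * q z = 1 \<and> q z * p z = 1)"
proof -
  define A where "A = weight_prod W"
  define P where "P n = bop_adj (A n) * A n" for n
  have A: "bop_invertible (A n)" for n
    unfolding A_def by (rule bop_invertible_weight_prod[OF assms(3)])
  then have P: "bop_invertible (P n)" for n
    by (simp add: P_def bop_invertible_mult bop_invertible_adj)
  have prod: "bop_invertible (prod_list (map W js))" for js
    by (rule bop_invertible_prod_list) (auto simp: assms(3))
  have p: "p (of_int n) = P n" for n
  proof -
    consider "n \<ge> 1" | "n = 0" | "n \<le> - 1" by linarith
    then show ?thesis
    proof cases
      case 1
      then show ?thesis
        by (simp add: assms(7) bop_abs_power2 prod P_def A_def weight_prod_def)
    next
      case 2
      then show ?thesis by (simp add: assms(6) P_def A_def)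
    next
      case 3
      define B where "B = prod_list (map W (rev [n + 1..0]))"
      have B: "bop_invertible B" unfolding B_def by (rule prod)
      \<comment> \<open>Taking adjoints reverses the order, so the increasing product of adjoints
        belongs to the decreasing product \<open>B\<close>, whose inverse is
        \<open>A n\<close>.\<close>
      have "prod_list (map (\<lambda>i. bop_adj (W i)) [n + 1..0]) = bop_adj B"
        by (simp add: B_def bop_adj_prod_list rev_map o_def)
      then have "p (of_int n) = bop_inv ((bop_abs (bop_adj B))\<^sup>2)"
        using assms(8)[of "- n"] 3 by simp
      also have "\<dots> = bop_adj (bop_inv B) * bop_inv B"
        by (simp add: bop_abs_power2 bop_inv_mult bop_inv_adj bop_invertible_adj B)
      also have "bop_inv B = A n" using 3 by (simp add: A_def weight_prod_def B_def)
      finally show ?thesis by (simp add: P_def)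
    qed
  qed
  have iff: "m_isometric m (bop_adj S) \<longleftrightarrow>
      (\<forall>n. (\<Sum>k=0..m. (real (m choose k) * (-1) ^ (m - k)) *\<^sub>R bop_inv (P (n + int k))) = 0)"
    unfolding P_def A_def by (rule m_isometric_adj_shift_iff[OF assms(2,3)])
  show ?thesis
  proof
    assume "m_isometric m (bop_adj S)"
    then obtain q where q: "q \<in> bop_polys (m - 1)" "\<And>n. q (of_int n) = bop_inv (P n)"
      using difference_zero_imp_bop_poly[OF assms(1), of "\<lambda>n. bop_inv (P n)"] iff by blast
    have "p (of_nat k) * q (of_nat k) = 1" "q (of_nat k) * p (of_nat k) = 1" for k
      using p[of "int k"] q(2)[of "int k"] by (simp_all add: bop_inv_right bop_inv_left P)
    then have "p z * q z = 1 \<and> q z * p z = 1" for z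
      using bop_polys_mult_eq_one[OF assms(5) q(1)] bop_polys_mult_eq_one[OF q(1) assms(5)] by blast
    then show "\<exists>q \<in> bop_polys (m - 1). \<forall>z. p z * q z = 1 \<and> q z * p z = 1"
      using q(1) by blast
  next
    assume "\<exists>q \<in> bop_polys (m - 1). \<forall>z. p z * q z = 1 \<and> q z * p z = 1"
    then obtain q where q: "q \<in> bop_polys (m - 1)" "\<And>z. p z * q z = 1" "\<And>z. q z * p z = 1"
      by blast
    \<comment> \<open>The inverses at the integers are values of a polynomial of degree below
      \<open>m\<close>, so their m-th differences vanish.\<close>
    have "bop_inv (P n) = q (of_int n)" for n
      using q(2,3)[of "of_int n"] by (intro bop_inv_eqI) (simp_all add: p)
    then show "m_isometric m (bop_adj S)"
      using bop_polys_difference[OF q(1), of m "of_int _"] assms(1) by (simp add: iff)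
  qed
qed

end
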